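(* Let $\phi:\mathbb{R}^n\to(0,\infty)$ be a radial, radially decreasing, lower semicontinuous (measurable) function with $\int_{\mathbb{R}^n}\phi\,dm=1$ satisfying the comparison condition $$\sup\left\{\frac{\phi_t(x)}{\phi(x)} : t\in(0,1),\ \|x\|>1\right\}<\infty .$$ Let $\mu$ be a measure on $\mathbb{R}^n$ such that $|\mu|\ast\phi_{t_0}(x_1)<\infty$ for some $t_0>0$ and $x_1\in\mathbb{R}^n$. If $x_0\in\mathbb{R}^n$ is a $\sigma$-point of $\mu$ with $D_\sigma\mu(x_0)=L\in\mathbb{C}$, then $\phi[\mu]$ has nontangential limit $L$ at $x_0$.
   Context: $m$ is Lebesgue measure on $\mathbb{R}^n$, $\|\cdot\|$ is the Euclidean norm, and $B(x,r)$ is the open Euclidean ball. "Measure" means a complex or signed Borel measure $\mu$ on $\mathbb{R}^n$ whose total variation $|\mu|$ is finite on compact sets (the total mass may be infinite; $\mu(E)$ and $(\mu-Lm)(E)=\mu(E)-L\,m(E)$ are only evaluated on bounded Borel sets $E$ below). Radial and radially decreasing: $\phi(x)=\phi(y)$ if $\|x\|=\|y\|$, and $\phi(x)\ge\phi(y)$ if $\|x\|<\|y\|$. Lower semicontinuous: $\{\phi>s\}$ is open for every real $s$. For $t>0$, $\phi_t(x)=t^{-n}\phi(x/t)$. The convolution integral is $\phi[\mu](x,t)=\mu\ast\phi_t(x)=\int_{\mathbb{R}^n}\phi_t(x-\xi)\,d\mu(\xi)$, whenever the integral exists, for $x\in\mathbb{R}^n$, $t>0$. (Known fact: if $|\mu|\ast\phi_{t_0}(x_1)<\infty$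 then $|\mu|\ast\phi_t(x)<\infty$ for all $x\in\mathbb{R}^n$, $0<t<t_0$, so $\phi[\mu]$ is defined on $\mathbb{R}^n\times(0,t_0)$.) $\sigma$-point: $x_0$ is a $\sigma$-point of $\mu$ with $D_\sigma\mu(x_0)=L\in\mathbb{C}$ if for each $\epsilon>0$ there is $\delta>0$ such that $|(\mu-Lm)(B(x,r))|<\epsilon(\|x-x_0\|+r)^n$ whenever $\|x-x_0\|<\delta$ and $0<r<\delta$. Nontangential limit: for $\alpha>0$ let $S(x_0,\alpha)=\{(x,t): x\in\mathbb{R}^n, t>0, \|x-x_0\|<\alpha t\}$. A function $u$ on $\mathbb{R}^n\times(0,\infty)$ or on $\mathbb{R}^n\times(0,t_0)$ has nontangential limit $L$ at $x_0$ if for every $\alpha>0$, $u(x,t)\to L$ as $(x,t)\to(x_0,0)$ with $(x,t)\in S(x_0,\alpha)$. *)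

theory Defs
  imports "HOL-Analysis.Analysis"
begin

text \<open>
  A complex or signed Borel measure whose total variation is finite on compact sets need not
  assign a value to unbounded sets. It is represented by its set function on the bounded Borel
  sets; the values of the function on other sets are irrelevant and never used. A signed measure
  is the case in which these values are real.

  The total variation is the usual supremum over countable Borel partitions, here into bounded
  pieces, so that it also makes sense for unbounded sets. It is a countably additive function of
  Borel sets whenever \<open>\<mu>\<close> is countably additive on the bounded ones, and then \<open>measure_of\<close>
  attains it. The same applies to \<open>upper_variation\<close>.
\<close>

definition total_variation :: "('a::euclidean_space set \<Rightarrow> complex) \<Rightarrow> 'a measure" where
  "total_variation \<mu> = measure_of UNIV (sets borel)
     (\<lambda>E. SUP A\<in>{A :: nat \<Rightarrow> 'a set. (\<forall>i. A i \<in> sets borel \<and> bounded (A i)) \<and>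
                   disjoint_family A \<and> (\<Union>i. A i) = E}.
            \<Sum>i. ennreal (norm (\<mu> (A i))))"

definition complex_borel_measure :: "('a::euclidean_space set \<Rightarrow> complex) \<Rightarrow> bool" where
  "complex_borel_measure \<mu> \<longleftrightarrow>
     (\<forall>A :: nat \<Rightarrow> 'a set.
        range A \<subseteq> sets borel \<longrightarrow> disjoint_family A \<longrightarrow> bounded (\<Union>i. A i) \<longrightarrow>
        (\<lambda>i. \<mu> (A i)) sums \<mu> (\<Union>i. A i)) \<and>
     (\<forall>K. compact K \<longrightarrow> emeasure (total_variation \<mu>) K < \<infinity>)"

text \<open>
  Jordan decomposition of a real set function \<open>\<nu>\<close>: the positive part is \<open>upper_variation \<nu>\<close>, the
  negative part is \<open>upper_variation (- \<nu>)\<close>. Here \<open>ennreal\<close> sends negative numbers to \<open>0\<close>, which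
  does not affect the supremum since the empty set is a competitor.
\<close>

definition upper_variation :: "('a::euclidean_space set \<Rightarrow> real) \<Rightarrow> 'a measure" where
  "upper_variation \<nu> = measure_of UNIV (sets borel)
     (\<lambda>E. SUP A\<in>{A \<in> sets borel. bounded A \<and> A \<subseteq> E}. ennreal (\<nu> A))"

definition signed_integral :: "('a::euclidean_space set \<Rightarrow> real) \<Rightarrow> ('a \<Rightarrow> real) \<Rightarrow> real" where
  "signed_integral \<nu> f =
     (LINT x|upper_variation \<nu>. f x) - (LINT x|upper_variation (\<lambda>A. - \<nu> A). f x)"

definition complex_integral :: "('a::euclidean_space set \<Rightarrow> complex) \<Rightarrow> ('a \<Rightarrow> real) \<Rightarrow> complex" where
  "complex_integral \<mu> f =
     Complex (signed_integral (\<lambda>A. Re (\<mu> A)) f) (signed_integral (\<lambda>A. Im (\<mu> A)) f)"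

definition dilate :: "('a::euclidean_space \<Rightarrow> real) \<Rightarrow> real \<Rightarrow> 'a \<Rightarrow> real" where
  "dilate \<phi> t x = \<phi> (x /\<^sub>R t) / t ^ DIM('a)"

definition convolution_integral ::
  "('a::euclidean_space \<Rightarrow> real) \<Rightarrow> ('a set \<Rightarrow> complex) \<Rightarrow> 'a \<Rightarrow> real \<Rightarrow> complex" where
  "convolution_integral \<phi> \<mu> x t = complex_integral \<mu> (\<lambda>\<xi>. dilate \<phi> t (x - \<xi>))"

definition abs_convolution ::
  "('a::euclidean_space \<Rightarrow> real) \<Rightarrow> ('a set \<Rightarrow> complex) \<Rightarrow> 'a \<Rightarrow> real \<Rightarrow> ennreal" where
  "abs_convolution \<phi> \<mu> x t = (\<integral>\<^sup>+ \<xi>. ennreal (dilate \<phi> t (x - \<xi>)) \<partial>total_variation \<mu>)"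

definition radial :: "('a::euclidean_space \<Rightarrow> real) \<Rightarrow> bool" where
  "radial \<phi> \<longleftrightarrow> (\<forall>x y. norm x = norm y \<longrightarrow> \<phi> x = \<phi> y)"

definition radially_decreasing :: "('a::euclidean_space \<Rightarrow> real) \<Rightarrow> bool" where
  "radially_decreasing \<phi> \<longleftrightarrow> (\<forall>x y. norm x < norm y \<longrightarrow> \<phi> y \<le> \<phi> x)"

definition lower_semicontinuous :: "('a::euclidean_space \<Rightarrow> real) \<Rightarrow> bool" where
  "lower_semicontinuous \<phi> \<longleftrightarrow> (\<forall>s. open {x. s < \<phi> x})"

definition comparison_condition :: "('a::euclidean_space \<Rightarrow> real) \<Rightarrow> bool" where
  "comparison_condition \<phi> \<longleftrightarrow>
     bdd_above {dilate \<phi> t x / \<phi> x | t x. 0 < t \<and> t < 1 \<and> 1 < norm x}"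

definition sigma_point ::
  "('a::euclidean_space set \<Rightarrow> complex) \<Rightarrow> 'a \<Rightarrow> complex \<Rightarrow> bool" where
  "sigma_point \<mu> x0 L \<longleftrightarrow>
     (\<forall>\<epsilon>>0. \<exists>\<delta>>0. \<forall>x r. norm (x - x0) < \<delta> \<longrightarrow> 0 < r \<longrightarrow> r < \<delta> \<longrightarrow>
        norm (\<mu> (ball x r) - L * of_real (measure lborel (ball x r)))
          < \<epsilon> * (norm (x - x0) + r) ^ DIM('a))"

definition nontangential_cone :: "'a::euclidean_space \<Rightarrow> real \<Rightarrow> ('a \<times> real) set" where
  "nontangential_cone x0 \<alpha> = {(x, t). 0 < t \<and> norm (x - x0) < \<alpha> * t}"

text \<open>
  Since \<open>t \<rightarrow> 0\<close> in the limit, only the values of \<open>u\<close> for small \<open>t\<close> matter, so this covers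
  functions defined for \<open>0 < t < t\<^sub>0\<close> only.
\<close>

definition has_nontangential_limit ::
  "('a::euclidean_space \<Rightarrow> real \<Rightarrow> complex) \<Rightarrow> complex \<Rightarrow> 'a \<Rightarrow> bool" where
  "has_nontangential_limit u L x0 \<longleftrightarrow>
     (\<forall>\<alpha>>0. ((\<lambda>(x, t). u x t) \<longlongrightarrow> L) (at (x0, 0) within nontangential_cone x0 \<alpha>))"

end

theory Submission
  imports Defs
begin

text \<open>
  By taking real and imaginary parts it suffices to treat a real set function
  \<open>\<nu> = P - Q\<close> with its two variations \<open>P\<close>, \<open>Q\<close>, which are dominated by the total variation of \<open>\<mu>\<close>.
  Truncate the kernel \<open>f = \<phi>\<^sub>t(x - \<cdot>)\<close> at its value \<open>c\<close> at a small fixed distance \<open>\<delta>/2\<close> from \<open>x\<close>: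
  \<open>f = max 0 (f - c) + min f c\<close>. The superlevel sets of the first part are balls around \<open>x\<close> of radius
  at most \<open>\<delta>/2\<close>, so the layer cake formula turns the \<open>\<sigma>\<close>-point condition on balls into a bound of
  its integral against \<open>\<nu> - l m\<close>. The integral of the second part against \<open>P\<close>, \<open>Q\<close> and \<open>m\<close>
  tends to \<open>0\<close>, because \<open>c\<close> does and because, by the comparison condition, far from \<open>x\<^sub>1\<close> the kernel
  \<open>f\<close> is dominated by a multiple of the integrable function \<open>\<phi>\<^bsub>t\<^sub>0\<^esub>(x\<^sub>1 - \<cdot>)\<close>.
\<close>

subsection \<open>Variations of locally additive set functions\<close>

text \<open>The additivity half of \<open>complex_borel_measure\<close>, with a general normed
  codomain so that it serves \<mu> as well as its real and imaginary parts and their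
  negatives.\<close>

definition locally_additive ::
  "('a::euclidean_space set \<Rightarrow> 'b::real_normed_vector) \<Rightarrow> bool" where
  "locally_additive \<mu> \<longleftrightarrow>
     (\<forall>A :: nat \<Rightarrow> 'a set.
        range A \<subseteq> sets borel \<longrightarrow> disjoint_family A \<longrightarrow> bounded (\<Union>i. A i) \<longrightarrow>
        (\<lambda>i. \<mu> (A i)) sums \<mu> (\<Union>i. A i))"

lemma locally_additiveD:
  fixes A :: "nat \<Rightarrow> 'a::euclidean_space set"
  assumes "locally_additive \<mu>" "range A \<subseteq> sets borel" "disjoint_family A" "bounded (\<Union>i. A i)"
  shows "(\<lambda>i. \<mu> (A i)) sums \<mu> (\<Union>i. A i)"
  using assms unfolding locally_additive_def by blast

lemma locally_additive_empty:
  assumes "locally_additive \<mu>"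
  shows "\<mu> {} = 0"
proof -
  have "(\<lambda>i::nat. \<mu> {}) sums \<mu> {}"
    using locally_additiveD[OF assms, of "\<lambda>_. {}"] by (simp add: disjoint_family_on_def)
  then have "summable (\<lambda>i::nat. \<mu> {})" by (rule sums_summable)
  then show ?thesis by (simp add: summable_const_iff)
qed

lemma locally_additive_Un:
  assumes "locally_additive \<mu>" "A \<in> sets borel" "B \<in> sets borel" "bounded A" "bounded B" "A \<inter> B = {}"
  shows "\<mu> (A \<union> B) = \<mu> A + \<mu> B"
proof -
  have "(\<lambda>i. \<mu> (binaryset A B i)) sums \<mu> (\<Union>i. binaryset A B i)"
    using assms
    by (intro locally_additiveD) (auto simp: UN_binaryset_eq range_binaryset_eq disjoint_family_on_def binaryset_def)
  moreover have "(\<lambda>i. \<mu> (binaryset A B i)) sums (\<mu> A + \<mu> B)"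
    using locally_additive_empty[OF assms(1)] by (rule binaryset_sums)
  ultimately show ?thesis
    using sums_unique2 by (fastforce simp: UN_binaryset_eq)
qed

section \<open>Countable additivity from superadditivity and countable subadditivity\<close>

text \<open>Subadditivity passes to partial sums by induction and to the limit by continuity. It is
  used with \<open>h\<close> the positive part (\<open>ennreal\<close>) and with \<open>h\<close>
  the norm, when a competitor of a variation is cut into countably many pieces.\<close>

lemma sums_le_suminf_subadditive:
  fixes h :: "'b::real_normed_vector \<Rightarrow> ennreal"
  assumes "f sums s" "continuous_on UNIV h" "h 0 = 0" and add: "\<And>x y. h (x + y) \<le> h x + h y"
  shows "h s \<le> (\<Sum>i. h (f i))"
proof -
  have fin: "h (\<Sum>i<n. f i) \<le> (\<Sum>i<n. h (f i))" for n
    by (induction n) (auto simp: assms(3) intro: order_trans[OF add] add_mono)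
  have "(\<lambda>n. h (\<Sum>i<n. f i)) \<longlonglongrightarrow> h s"
    using assms(1,2) by (auto simp: sums_def intro: continuous_on_tendsto_compose)
  then show ?thesis
  proof (rule tendsto_upperbound)
    show "\<forall>\<^sub>F n in sequentially. h (\<Sum>i<n. f i) \<le> (\<Sum>i. h (f i))"
      by (intro always_eventually allI order_trans[OF fin] sum_le_suminf) auto
  qed simp
qed

lemma ennreal_add_le: "ennreal (x + y) \<le> ennreal x + ennreal y"
  by (cases "0 \<le> x"; cases "0 \<le> y")
    (auto simp: ennreal_neg intro!: ennreal_leI simp flip: ennreal_plus)

text \<open>Addition moves inside a supremum in \<open>ennreal\<close> only over a nonempty index
  set, an empty supremum being 0.\<close>

lemma SUP_add_SUP_le_ennreal:
  fixes f g :: "_ \<Rightarrow> ennreal"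
  assumes "I \<noteq> {}" "J \<noteq> {}" "\<And>i j. i \<in> I \<Longrightarrow> j \<in> J \<Longrightarrow> f i + g j \<le> c"
  shows "(SUP i\<in>I. f i) + (SUP j\<in>J. g j) \<le> c"
proof -
  have "f i + (SUP j\<in>J. g j) \<le> c" if "i \<in> I" for i
    using that assms by (auto simp: ennreal_SUP_add_right intro!: SUP_least)
  then show ?thesis
    using assms by (auto simp: ennreal_SUP_add_left[symmetric] intro!: SUP_least)
qed

text \<open>Tailored to suprema: competitors for disjoint sets can be joined, and a competitor for a
  union can be cut. Superadditivity also yields monotonicity, so all partial sums lie below
  \<open>T\<close> of the union; subadditivity gives the reverse inequality.\<close>

lemma countably_additive_if_super_sub:
  fixes T :: "'a set \<Rightarrow> ennreal"
  assumes super: "\<And>A B. A \<in> sets M \<Longrightarrow> B \<in> sets M \<Longrightarrow> A \<inter> B = {} \<Longrightarrow> T A + T B \<le> T (A \<union> B)"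
    and sub: "\<And>A::nat \<Rightarrow> _. range A \<subseteq> sets M \<Longrightarrow> disjoint_family A \<Longrightarrow> T (\<Union>i. A i) \<le> (\<Sum>i. T (A i))"
    and empty: "T {} = 0"
  shows "countably_additive (sets M) T"
proof (rule countably_additiveI)
  fix A :: "nat \<Rightarrow> 'a set"
  assume A: "range A \<subseteq> sets M" "disjoint_family A"
  have fin: "(\<Sum>i<n. T (A i)) \<le> T (\<Union>i<n. A i)" for n
  proof (induction n)
    case (Suc n)
    have "(\<Sum>i<Suc n. T (A i)) \<le> T (\<Union>i<n. A i) + T (A n)"
      using Suc by (auto intro: add_mono)
    also have "\<dots> \<le> T ((\<Union>i<n. A i) \<union> A n)"
      using A disjoint_family_onD[OF A(2), of _ n] by (intro super) (auto dest: less_imp_neq)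
    also have "(\<Union>i<n. A i) \<union> A n = (\<Union>i<Suc n. A i)"
      by (auto simp: less_Suc_eq)
    finally show ?case .
  qed (simp add: empty)
  have mono: "T X \<le> T Y" if "X \<in> sets M" "Y \<in> sets M" "X \<subseteq> Y" for X Y
  proof -
    have "T X \<le> T X + T (Y - X)" by simp
    also have "\<dots> \<le> T (X \<union> (Y - X))" using that by (intro super) auto
    also have "X \<union> (Y - X) = Y" using that by auto
    finally show ?thesis .
  qed
  have "(\<Sum>i<n. T (A i)) \<le> T (\<Union>i. A i)" for n
    using A by (intro order_trans[OF fin] mono) auto
  then have "(\<Sum>i. T (A i)) \<le> T (\<Union>i. A i)"
    by (intro suminf_le_const) auto
  then show "(\<Sum>i. T (A i)) = T (\<Union>i. A i)"
    using sub[OF A] by (rule antisym)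
qed

section \<open>Positive and negative variations of a real set function\<close>

lemma sets_upper_variation [simp, measurable_cong]: "sets (upper_variation \<nu>) = sets borel"
  by (simp add: upper_variation_def sets.sigma_sets_eq[of borel, simplified])

lemma space_upper_variation [simp]: "space (upper_variation \<nu>) = UNIV"
  by (simp add: upper_variation_def)

text \<open>\<open>measure_of\<close> returns the supremum once that is known to be countably
  additive. Competitors \<open>A'\<close> and \<open>B'\<close> are joined for superadditivity; a
  competitor inside a union is cut along the \<open>E i\<close>, its boundedness making additivity
  of \<nu> applicable.\<close>

lemma emeasure_upper_variation:
  assumes \<nu>: "locally_additive \<nu>" and E: "E \<in> sets borel"
  shows "emeasure (upper_variation \<nu>) E = (SUP A\<in>{A \<in> sets borel. bounded A \<and> A \<subseteq> E}. ennreal (\<nu> A))"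
proof -
  define U where "U E = (SUP A\<in>{A \<in> sets borel. bounded A \<and> A \<subseteq> E}. ennreal (\<nu> A))" for E
  have U_empty: "U {} = 0"
  proof -
    have "{A \<in> sets borel. bounded A \<and> A \<subseteq> {}} = {{}}" by auto
    then show ?thesis by (simp add: U_def locally_additive_empty[OF \<nu>])
  qed
  have le_U: "ennreal (\<nu> A) \<le> U E" if "A \<in> sets borel" "bounded A" "A \<subseteq> E" for A E
    unfolding U_def using that by (intro SUP_upper) auto
  have "countably_additive (sets borel) U"
  proof (rule countably_additive_if_super_sub[where M = borel])
    fix A B :: "'a set" assume AB: "A \<in> sets borel" "B \<in> sets borel" "A \<inter> B = {}"
    have "ennreal (\<nu> A') + ennreal (\<nu> B') \<le> U (A \<union> B)"
      if A': "A' \<in> sets borel" "bounded A'" "A' \<subseteq> A" and B': "B' \<in> sets borel" "bounded B'" "B' \<subseteq> B" for A' B'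
    proof (cases "0 \<le> \<nu> A' \<and> 0 \<le> \<nu> B'")
      case True
      then have "ennreal (\<nu> A') + ennreal (\<nu> B') = ennreal (\<nu> A' + \<nu> B')" by simp
      also have "\<nu> A' + \<nu> B' = \<nu> (A' \<union> B')"
        using A' B' AB by (intro locally_additive_Un[OF \<nu>, symmetric]) auto
      also have "ennreal \<dots> \<le> U (A \<union> B)"
        using A' B' by (intro le_U) auto
      finally show ?thesis .
    next
      \<comment> \<open>A negative value becomes 0 in \<open>ennreal\<close>, so at most one summand
        survives and monotonicity bounds it.\<close>
      case False
      then show ?thesis
        using le_U[of A' "A \<union> B"] le_U[of B' "A \<union> B"] A' B' by (auto simp: ennreal_neg le_supI1 le_supI2)
    qed
    then show "U A + U B \<le> U (A \<union> B)"
      unfolding U_def[of A] U_def[of B] by (intro SUP_add_SUP_le_ennreal) auto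
  next
    fix E :: "nat \<Rightarrow> 'a set" assume E: "range E \<subseteq> sets borel" "disjoint_family E"
    show "U (\<Union>i. E i) \<le> (\<Sum>i. U (E i))"
      unfolding U_def[of "\<Union>i. E i"]
    proof (rule SUP_least)
      fix A assume "A \<in> {A \<in> sets borel. bounded A \<and> A \<subseteq> (\<Union>i. E i)}"
      then have A: "A \<in> sets borel" "bounded A" "A = (\<Union>i. A \<inter> E i)" by auto
      have "(\<lambda>i. \<nu> (A \<inter> E i)) sums \<nu> (\<Union>i. A \<inter> E i)"
        using A E disjoint_family_subset[OF E(2), of "\<lambda>i. A \<inter> E i"]
        by (intro locally_additiveD[OF \<nu>]) auto
      then have "ennreal (\<nu> A) \<le> (\<Sum>i. ennreal (\<nu> (A \<inter> E i)))"
        unfolding A(3)[symmetric]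
        by (rule sums_le_suminf_subadditive)
          (auto intro!: continuous_on_ennreal continuous_on_id ennreal_add_le)
      also have "\<dots> \<le> (\<Sum>i. U (E i))"
        using A E by (intro suminf_le le_U) (auto intro: bounded_subset)
      finally show "ennreal (\<nu> A) \<le> (\<Sum>i. U (E i))" .
    qed
  qed (rule U_empty)
  then have "emeasure (upper_variation \<nu>) E = U E"
    using E
    by (intro emeasure_measure_of[OF upper_variation_def[of \<nu>, folded U_def]])
      (auto simp: positive_def U_empty)
  then show ?thesis by (simp add: U_def)
qed

section \<open>The total variation\<close>

lemma sets_total_variation [simp, measurable_cong]: "sets (total_variation \<mu>) = sets borel"
  by (simp add: total_variation_def sets.sigma_sets_eq[of borel, simplified])

lemma space_total_variation [simp]: "space (total_variation \<mu>) = UNIV"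
  by (simp add: total_variation_def)

text \<open>Makes the supremum defining the total variation range over a nonempty set even for
  unbounded \<open>E\<close>: intersect with balls of integer radius and disjointify.\<close>

lemma bounded_borel_partition:
  fixes E :: "'a::euclidean_space set"
  assumes "E \<in> sets borel"
  obtains A :: "nat \<Rightarrow> 'a set" where "\<And>i. A i \<in> sets borel" "\<And>i. bounded (A i)"
    "disjoint_family A" "(\<Union>i. A i) = E"
proof
  define B where "B = (\<lambda>i::nat. E \<inter> ball 0 (real i))"
  have B: "range B \<subseteq> sets borel" "\<And>i. bounded (B i)"
    using assms by (auto simp: B_def intro: bounded_subset[OF bounded_ball])
  show "disjointed B i \<in> sets borel" for i
    using sets.range_disjointed_sets[OF B(1)] by auto
  show "bounded (disjointed B i)" for i
    using B(2) disjointed_subset by (rule bounded_subset)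
  show "disjoint_family (disjointed B)"
    by (rule disjoint_family_disjointed)
  show "(\<Union>i. disjointed B i) = E"
    using reals_Archimedean2 by (auto simp: UN_disjointed_eq B_def)
qed

text \<open>The same criterion: partitions of two disjoint sets are interleaved into one of their
  union, and a partition of a union is refined by its intersections with the
  \<open>E i\<close>.\<close>

lemma emeasure_total_variation:
  assumes \<mu>: "locally_additive \<mu>" and E: "E \<in> sets borel"
  shows "emeasure (total_variation \<mu>) E =
    (SUP A\<in>{A :: nat \<Rightarrow> 'a::euclidean_space set. (\<forall>i. A i \<in> sets borel \<and> bounded (A i)) \<and>
                   disjoint_family A \<and> (\<Union>i. A i) = E}.
            \<Sum>i. ennreal (norm (\<mu> (A i))))"
proof -
  define P where "P E = {A :: nat \<Rightarrow> 'a set. (\<forall>i. A i \<in> sets borel \<and> bounded (A i)) \<and>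
                   disjoint_family A \<and> (\<Union>i. A i) = E}" for E
  define T where "T E = (SUP A\<in>P E. \<Sum>i. ennreal (norm (\<mu> (A i))))" for E
  have \<mu>0: "\<mu> {} = 0" by (rule locally_additive_empty[OF \<mu>])
  have T_empty: "T {} = 0"
    by (auto simp: T_def P_def \<mu>0 intro!: antisym SUP_least)
  have P_nonempty: "P E \<noteq> {}" if "E \<in> sets borel" for E
    using that by (elim bounded_borel_partition) (auto simp: P_def)
  have "countably_additive (sets borel) T"
  proof (rule countably_additive_if_super_sub[where M = borel])
    fix E F :: "'a set" assume EF: "E \<in> sets borel" "F \<in> sets borel" "E \<inter> F = {}"
    have "(\<Sum>i. ennreal (norm (\<mu> (A i)))) + (\<Sum>i. ennreal (norm (\<mu> (B i)))) \<le> T (E \<union> F)"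
      if A: "A \<in> P E" and B: "B \<in> P F" for A B
    proof -
      define C where "C = (\<lambda>i. if even i then A (i div 2) else B (i div 2))"
      have "C \<in> P (E \<union> F)"
      proof -
        have AB: "A i \<inter> B j = {}" "B j \<inter> A i = {}" for i j
        proof -
          have "A i \<subseteq> E" "B j \<subseteq> F" using A B unfolding P_def by auto
          then show "A i \<inter> B j = {}" "B j \<inter> A i = {}" using EF(3) by auto
        qed
        have AA: "A i \<inter> A j = {}" "B i \<inter> B j = {}" if "i \<noteq> j" for i j
          using A B that by (auto simp: P_def disjoint_family_on_def)
        have "C i \<inter> C j = {}" if "i \<noteq> j" for i j
        proof -
          have "i div 2 \<noteq> j div 2 \<or> (even i \<longleftrightarrow> odd j)"
            using that by presburger
          then show ?thesis
            using AB AA by (cases "even i"; cases "even j") (simp_all add: C_def)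
        qed
        then have "disjoint_family C"
          by (auto simp: disjoint_family_on_def)
        moreover have "(\<Union>i. C i) = (\<Union>i. A i) \<union> (\<Union>i. B i)"
        proof (intro antisym subsetI)
          fix x assume "x \<in> (\<Union>i. A i) \<union> (\<Union>i. B i)"
          then obtain i where "x \<in> A i \<or> x \<in> B i" by blast
          then have "x \<in> C (2 * i) \<or> x \<in> C (2 * i + 1)"
            by (simp add: C_def)
          then show "x \<in> (\<Union>i. C i)" by blast
        qed (auto simp: C_def split: if_splits)
        moreover have "C i \<in> sets borel \<and> bounded (C i)" for i
          using A B by (simp add: P_def C_def)
        moreover have "(\<Union>i. A i) = E" "(\<Union>i. B i) = F"
          using A B by (simp_all add: P_def)
        ultimately show ?thesis
          unfolding P_def by simp
      qed
      \<comment> \<open>The first \<open>2 * n\<close> terms of the interleaving pair up, so partial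
        sums of the paired series are partial sums of the series over \<open>C\<close>.\<close>
      have fin: "(\<Sum>i<2*n. ennreal (norm (\<mu> (C i)))) =
        (\<Sum>i<n. ennreal (norm (\<mu> (A i))) + ennreal (norm (\<mu> (B i))))" for n
        by (induction n) (simp_all add: C_def algebra_simps)
      have "(\<Sum>i. ennreal (norm (\<mu> (A i)))) + (\<Sum>i. ennreal (norm (\<mu> (B i)))) =
        (\<Sum>i. ennreal (norm (\<mu> (A i))) + ennreal (norm (\<mu> (B i))))"
        by (intro suminf_add) auto
      also have "\<dots> \<le> (\<Sum>i. ennreal (norm (\<mu> (C i))))"
        by (intro suminf_le_const summableI) (auto simp flip: fin simp del: sum_ennreal intro!: sum_le_suminf)
      also have "\<dots> \<le> T (E \<union> F)"
        unfolding T_def using \<open>C \<in> P (E \<union> F)\<close> by (rule SUP_upper)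
      finally show ?thesis .
    qed
    then show "T E + T F \<le> T (E \<union> F)"
      unfolding T_def[of E] T_def[of F] using EF P_nonempty by (intro SUP_add_SUP_le_ennreal) auto
  next
    fix E :: "nat \<Rightarrow> 'a set" assume E: "range E \<subseteq> sets borel" "disjoint_family E"
    show "T (\<Union>i. E i) \<le> (\<Sum>i. T (E i))"
      unfolding T_def[of "\<Union>i. E i"]
    proof (rule SUP_least)
      fix A assume "A \<in> P (\<Union>i. E i)"
      then have A: "\<And>i. A i \<in> sets borel" "\<And>i. bounded (A i)" "disjoint_family A"
        "(\<Union>i. A i) = (\<Union>i. E i)" by (auto simp: P_def)
      have "ennreal (norm (\<mu> (A j))) \<le> (\<Sum>i. ennreal (norm (\<mu> (A j \<inter> E i))))" for j
      proof -
        have Aj: "(\<Union>i. A j \<inter> E i) = A j" using A(4) by auto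
        have "(\<lambda>i. \<mu> (A j \<inter> E i)) sums \<mu> (\<Union>i. A j \<inter> E i)"
          using A E Aj disjoint_family_subset[OF E(2), of "\<lambda>i. A j \<inter> E i"]
          by (intro locally_additiveD[OF \<mu>]) auto
        then show ?thesis
          unfolding Aj
          by (rule sums_le_suminf_subadditive[where h = "\<lambda>x. ennreal (norm x)"])
            (auto intro!: continuous_on_ennreal continuous_intros ennreal_leI norm_triangle_ineq simp flip: ennreal_plus)
      qed
      then have "(\<Sum>j. ennreal (norm (\<mu> (A j)))) \<le> (\<Sum>j. \<Sum>i. ennreal (norm (\<mu> (A j \<inter> E i))))"
        by (rule suminf_le[OF _ summableI summableI])
      \<comment> \<open>Tonelli for a double series, with the outer sum written as an integral over
        counting measure.\<close>
      also have "\<dots> = (\<Sum>i. \<Sum>j. ennreal (norm (\<mu> (A j \<inter> E i))))"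
      proof -
        have "(\<integral>\<^sup>+ j. (\<Sum>i. ennreal (norm (\<mu> (A j \<inter> E i)))) \<partial>count_space UNIV) =
          (\<Sum>i. \<integral>\<^sup>+ j. ennreal (norm (\<mu> (A j \<inter> E i))) \<partial>count_space UNIV)"
          by (rule nn_integral_suminf) simp
        then show ?thesis by (simp only: nn_integral_count_space_nat)
      qed
      also have "\<dots> \<le> (\<Sum>i. T (E i))"
      proof (rule suminf_le[OF _ summableI summableI])
        fix i
        have "(\<lambda>j. A j \<inter> E i) \<in> P (E i)"
          unfolding P_def
        proof (intro CollectI conjI allI)
          show "A j \<inter> E i \<in> sets borel" "bounded (A j \<inter> E i)" for j
            using A(1,2) E(1) by (auto intro: bounded_subset)
          show "disjoint_family (\<lambda>j. A j \<inter> E i)"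
            by (rule disjoint_family_subset[OF A(3)]) auto
          show "(\<Union>j. A j \<inter> E i) = E i"
            using A(4) by blast
        qed
        then show "(\<Sum>j. ennreal (norm (\<mu> (A j \<inter> E i)))) \<le> T (E i)"
          unfolding T_def by (rule SUP_upper)
      qed
      finally show "(\<Sum>j. ennreal (norm (\<mu> (A j)))) \<le> (\<Sum>i. T (E i))" .
    qed
  qed (rule T_empty)
  then have "emeasure (total_variation \<mu>) E = T E"
    using E
    by (intro emeasure_measure_of[OF total_variation_def[of \<mu>, folded P_def, folded T_def]])
      (auto simp: positive_def T_empty)
  then show ?thesis by (simp add: T_def P_def)
qed

text \<open>Compare with the partition of \<open>A\<close> into itself and empty sets, which have
  value 0.\<close>

lemma norm_le_emeasure_total_variation:
  assumes "locally_additive \<mu>" "A \<in> sets borel" "bounded A"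
  shows "ennreal (norm (\<mu> A)) \<le> emeasure (total_variation \<mu>) A"
proof -
  have "ennreal (norm (\<mu> A)) = (\<Sum>i. ennreal (norm (\<mu> (if i = 0 then A else {}))))"
    by (subst suminf_finite[of "{0}"]) (simp_all add: locally_additive_empty[OF assms(1)])
  also have "\<dots> \<le> emeasure (total_variation \<mu>) A"
    unfolding emeasure_total_variation[OF assms(1,2)] using assms
    by (intro SUP_upper) (auto simp: disjoint_family_on_def)
  finally show ?thesis .
qed

text \<open>The variation is a supremum of values, so a one-sided bound is enough; hence this covers
  the real and imaginary parts of \<mu> and their negatives.\<close>

lemma upper_variation_le_total_variation:
  assumes "locally_additive \<mu>" "locally_additive \<nu>" "\<And>A. \<nu> A \<le> norm (\<mu> A)" "E \<in> sets borel"
  shows "emeasure (upper_variation \<nu>) E \<le> emeasure (total_variation \<mu>) E"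
  unfolding emeasure_upper_variation[OF assms(2,4)]
proof (rule SUP_least)
  fix A assume A: "A \<in> {A \<in> sets borel. bounded A \<and> A \<subseteq> E}"
  have "ennreal (\<nu> A) \<le> ennreal (norm (\<mu> A))" using assms(3) by (rule ennreal_leI)
  also have "\<dots> \<le> emeasure (total_variation \<mu>) A"
    using A by (intro norm_le_emeasure_total_variation[OF assms(1)]) auto
  also have "\<dots> \<le> emeasure (total_variation \<mu>) E"
    using A assms by (intro emeasure_mono) auto
  finally show "ennreal (\<nu> A) \<le> emeasure (total_variation \<mu>) E" .
qed

text \<open>Passing from \<open>A\<close> to \<open>E - A\<close> in the supremum turns one variation into the other.\<close>

lemma upper_variation_diff:
  assumes \<nu>: "locally_additive \<nu>" and E: "E \<in> sets borel" "bounded E"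
    and fin: "emeasure (upper_variation \<nu>) E < \<infinity>"
      "emeasure (upper_variation (\<lambda>A. - \<nu> A)) E < \<infinity>"
  shows "measure (upper_variation \<nu>) E - measure (upper_variation (\<lambda>A. - \<nu> A)) E = \<nu> E"
proof -
  \<comment> \<open>One inequality for every such \<nu>; the reverse one is this inequality for
    \<open>\<lambda>A. - \<nu> A\<close>.\<close>
  have *: "measure (upper_variation \<nu>) E \<le> \<nu> E + measure (upper_variation (\<lambda>A. - \<nu> A)) E"
    if \<nu>: "locally_additive \<nu>" and fin: "emeasure (upper_variation \<nu>) E < \<infinity>"
      "emeasure (upper_variation (\<lambda>A. - \<nu> A)) E < \<infinity>" for \<nu> :: "'a set \<Rightarrow> real"
  proof -
    have \<nu>': "locally_additive (\<lambda>A. - \<nu> A)"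
      using \<nu> unfolding locally_additive_def by (auto intro: sums_minus)
    let ?m = "measure (upper_variation (\<lambda>A. - \<nu> A)) E"
    have le: "- \<nu> A \<le> ?m" if "A \<in> sets borel" "A \<subseteq> E" for A
    proof -
      have "ennreal (- \<nu> A) \<le> emeasure (upper_variation (\<lambda>A. - \<nu> A)) E"
        unfolding emeasure_upper_variation[OF \<nu>' E(1)]
        using that E(2) by (intro SUP_upper) (auto intro: bounded_subset)
      also have "\<dots> = ennreal ?m"
        using fin by (intro emeasure_eq_ennreal_measure) auto
      finally show ?thesis by (auto simp: ennreal_le_iff2 intro: order_trans[OF _ measure_nonneg])
    qed
    have "emeasure (upper_variation \<nu>) E \<le> ennreal (\<nu> E + ?m)"
      unfolding emeasure_upper_variation[OF \<nu> E(1)]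
    proof (rule SUP_least)
      fix A assume A: "A \<in> {A \<in> sets borel. bounded A \<and> A \<subseteq> E}"
      have "\<nu> (A \<union> (E - A)) = \<nu> A + \<nu> (E - A)"
        using A E by (intro locally_additive_Un[OF \<nu>]) (auto intro: bounded_subset)
      moreover have "A \<union> (E - A) = E" using A by auto
      ultimately show "ennreal (\<nu> A) \<le> ennreal (\<nu> E + ?m)"
        using le[of "E - A"] A E by (intro ennreal_leI) auto
    qed
    \<comment> \<open>Use the competitor \<open>E\<close> itself; nonnegativity keeps
      \<open>ennreal\<close> from truncating on the way back to the reals.\<close>
    moreover have "0 \<le> \<nu> E + ?m" using le[of E] E by simp
    ultimately show ?thesis
      using enn2real_mono[of "emeasure (upper_variation \<nu>) E" "ennreal (\<nu> E + ?m)"]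
      by (simp add: measure_def)
  qed
  have "locally_additive (\<lambda>A. - \<nu> A)"
    using \<nu> unfolding locally_additive_def by (auto intro: sums_minus)
  then show ?thesis
    using *[OF \<nu> fin] *[of "\<lambda>A. - \<nu> A"] fin by simp
qed

subsection \<open>Tails and the layer cake formula\<close>

text \<open>Dominated convergence: for each \<xi> the indicator vanishes as soon as \<open>R\<close>
  reaches \<open>norm (x - \<xi>)\<close>. With Lebesgue measure it gives the decay of \<phi>, with
  a general measure the tail in the far estimate.\<close>

lemma integral_tail_small:
  fixes F :: "'a::euclidean_space \<Rightarrow> real"
  assumes M: "sets M = sets borel" and F: "integrable M F" and "0 < \<epsilon>"
  obtains R0 where "\<And>R. R0 \<le> R \<Longrightarrow> (LINT \<xi>|M. indicator {\<xi>. R < norm (x - \<xi>)} \<xi> * F \<xi>) < \<epsilon>"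
proof -
  note [measurable_cong] = M
  have [measurable]: "F \<in> borel_measurable M" using F by auto
  have "((\<lambda>R. LINT \<xi>|M. indicator {\<xi>. R < norm (x - \<xi>)} \<xi> * F \<xi>) \<longlongrightarrow> (LINT \<xi>|M. 0)) at_top"
  proof (rule integral_dominated_convergence_at_top[where w = "\<lambda>\<xi>. norm (F \<xi>)"])
    show "AE \<xi> in M. ((\<lambda>R. indicator {\<xi>. R < norm (x - \<xi>)} \<xi> * F \<xi>) \<longlongrightarrow> 0) at_top"
    proof (rule AE_I2)
      fix \<xi>
      have "\<forall>\<^sub>F R in at_top. indicator {\<xi>. R < norm (x - \<xi>)} \<xi> * F \<xi> = 0"
        using eventually_ge_at_top[of "norm (x - \<xi>)"] by eventually_elim auto
      then show "((\<lambda>R. indicator {\<xi>. R < norm (x - \<xi>)} \<xi> * F \<xi>) \<longlongrightarrow> 0) at_top"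
        by (rule tendsto_eventually)
    qed
    show "\<forall>\<^sub>F R in at_top. AE \<xi> in M. norm (indicator {\<xi>. R < norm (x - \<xi>)} \<xi> * F \<xi>) \<le> norm (F \<xi>)"
      by (intro always_eventually allI AE_I2) (auto simp: indicator_def)
  qed (use F in auto)
  then have "\<forall>\<^sub>F R in at_top. (LINT \<xi>|M. indicator {\<xi>. R < norm (x - \<xi>)} \<xi> * F \<xi>) < \<epsilon>"
    using \<open>0 < \<epsilon>\<close> by (intro order_tendstoD(2)) auto
  then show ?thesis
    using that by (auto simp: eventually_at_top_linorder)
qed

text \<open>Balls of integer radius cover the space; the result feeds Fubini in the layer cake
  formula.\<close>

lemma sigma_finite_if_finite_on_balls:
  fixes M :: "'a::euclidean_space measure"
  assumes "sets M = sets borel" "\<And>r. emeasure M (ball 0 r) < \<infinity>"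
  shows "sigma_finite_measure M"
proof
  have sp: "space M = UNIV" using sets_eq_imp_space_eq[OF assms(1)] by simp
  show "\<exists>A. countable A \<and> A \<subseteq> sets M \<and> \<Union> A = space M \<and> (\<forall>a\<in>A. emeasure M a \<noteq> \<infinity>)"
  proof (intro exI conjI ballI)
    show "\<Union> (range (\<lambda>n::nat. ball (0::'a) (real n))) = space M"
      unfolding sp using reals_Archimedean2 by auto
  qed (use assms in \<open>auto simp: less_top\<close>)
qed

text \<open>Integrate the indicator \<open>k\<close> of \<open>0 \<le> s < g \<xi>\<close> in both
  orders. The integral over \<open>s\<close> is a real Bochner integral so that the formulas for
  several measures can be subtracted. Finiteness at level 0 covers all higher levels; on a set of
  infinite mass \<open>measure\<close> would be the default 0.\<close>

lemma has_bochner_integral_layer_cake: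
  fixes g :: "'a \<Rightarrow> real"
  assumes M: "sigma_finite_measure M" and g: "integrable M g" "\<And>\<xi>. 0 \<le> g \<xi>"
    and fin: "emeasure M {\<xi> \<in> space M. 0 < g \<xi>} < \<infinity>"
  shows "has_bochner_integral lborel
    (\<lambda>s. indicator {0..} s * measure M {\<xi> \<in> space M. s < g \<xi>}) (LINT \<xi>|M. g \<xi>)"
proof -
  interpret M: sigma_finite_measure M by (rule M)
  interpret pair_sigma_finite M "lborel :: real measure" ..
  have [measurable]: "g \<in> borel_measurable M" using g by auto
  define k :: "'a \<Rightarrow> real \<Rightarrow> ennreal" where "k \<xi> s = (if 0 \<le> s \<and> s < g \<xi> then 1 else 0)" for \<xi> s
  have k_meas: "(\<lambda>(\<xi>, s). k \<xi> s) \<in> borel_measurable (M \<Otimes>\<^sub>M lborel)"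
    unfolding k_def by measurable
  have fin': "emeasure M {\<xi> \<in> space M. s < g \<xi>} < \<infinity>" if "0 \<le> s" for s
    using that by (intro le_less_trans[OF emeasure_mono fin]) auto
  have k1: "(\<integral>\<^sup>+ \<xi>. k \<xi> s \<partial>M) = ennreal (indicator {0..} s * measure M {\<xi> \<in> space M. s < g \<xi>})" for s
  proof (cases "0 \<le> s")
    case True
    have "(\<integral>\<^sup>+ \<xi>. k \<xi> s \<partial>M) = (\<integral>\<^sup>+ \<xi>. indicator {\<xi> \<in> space M. s < g \<xi>} \<xi> \<partial>M)"
      using True by (intro nn_integral_cong) (auto simp: k_def)
    then show ?thesis
      using True fin'[of s] by (simp add: emeasure_eq_ennreal_measure)
  qed (simp add: k_def)
  have k2: "(\<integral>\<^sup>+ s. k \<xi> s \<partial>lborel) = ennreal (g \<xi>)" for \<xi>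
  proof -
    have "(\<integral>\<^sup>+ s. k \<xi> s \<partial>lborel) = (\<integral>\<^sup>+ s. indicator {0..<g \<xi>} s \<partial>lborel)"
      by (intro nn_integral_cong) (auto simp: k_def)
    then show ?thesis using g(2) by simp
  qed
  have meas: "(\<lambda>s. indicator {0..} s * measure M {\<xi> \<in> space M. s < g \<xi>}) \<in> borel_measurable lborel"
  proof -
    have "(\<lambda>s. \<integral>\<^sup>+ \<xi>. k \<xi> s \<partial>M) \<in> borel_measurable lborel"
      using k_meas by (intro M.borel_measurable_nn_integral) (simp add: measurable_pair_swap_iff[of _ lborel] case_prod_beta')
    then have "(\<lambda>s. enn2real (\<integral>\<^sup>+ \<xi>. k \<xi> s \<partial>M)) \<in> borel_measurable lborel"
      by measurable
    then show ?thesis by (simp add: k1)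
  qed
  show ?thesis
  proof (rule has_bochner_integral_nn_integral[OF meas])
    have "(\<integral>\<^sup>+ s. (\<integral>\<^sup>+ \<xi>. k \<xi> s \<partial>M) \<partial>lborel) = (\<integral>\<^sup>+ \<xi>. (\<integral>\<^sup>+ s. k \<xi> s \<partial>lborel) \<partial>M)"
      using Fubini[OF k_meas] by simp
    then show "(\<integral>\<^sup>+ s. ennreal (indicator {0..} s * measure M {\<xi> \<in> space M. s < g \<xi>}) \<partial>lborel) =
      ennreal (LINT \<xi>|M. g \<xi>)"
      using g by (simp add: k1 k2 nn_integral_eq_integral)
    show "0 \<le> (LINT \<xi>|M. g \<xi>)" using g by simp
  qed simp
qed

subsection \<open>Radially decreasing kernels\<close>

locale radial_kernel =
  fixes \<phi> :: "'a::euclidean_space \<Rightarrow> real"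
  assumes pos: "0 < \<phi> x"
    and radial: "radial \<phi>"
    and decreasing: "radially_decreasing \<phi>"
    and lsc: "lower_semicontinuous \<phi>"
    and integral_one: "has_bochner_integral lborel \<phi> 1"
begin

lemma mono: "norm x \<le> norm y \<Longrightarrow> \<phi> y \<le> \<phi> x"
  using radial decreasing unfolding radial_def radially_decreasing_def
  by (metis order_le_less order_refl)

lemma measurable_kernel [measurable]: "\<phi> \<in> borel_measurable borel"
  using integral_one by (auto elim: has_bochner_integral.cases)

lemma dilate_pos: "0 < t \<Longrightarrow> 0 < dilate \<phi> t x"
  by (simp add: dilate_def pos)

lemma dilate_mono: "0 < t \<Longrightarrow> norm x \<le> norm y \<Longrightarrow> dilate \<phi> t y \<le> dilate \<phi> t x"
  by (auto simp: dilate_def intro!: divide_right_mono mono mult_left_mono)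

lemma measurable_dilate [measurable]: "(\<lambda>\<xi>. dilate \<phi> t (x - \<xi>)) \<in> borel_measurable borel"
  unfolding dilate_def by measurable

text \<open>Substitute \<xi> = x - t y; the Jacobian \<open>t ^ DIM('a)\<close> cancels the
  normalising factor of \<open>dilate\<close>.\<close>

lemma integral_dilate:
  assumes "0 < t"
  shows "has_bochner_integral lborel (\<lambda>\<xi>. dilate \<phi> t (x - \<xi>)) 1"
proof (rule has_bochner_integral_nn_integral)
  have "(\<integral>\<^sup>+ \<xi>. ennreal (dilate \<phi> t (x - \<xi>)) \<partial>lborel) =
    (\<integral>\<^sup>+ \<xi>. ennreal (dilate \<phi> t (x - \<xi>)) \<partial>density (distr lborel borel (\<lambda>y. x + (- t) *\<^sub>R y)) (\<lambda>_. \<bar>- t\<bar> ^ DIM('a)))"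
    using assms by (subst lborel_affine[of "- t" x]) auto
  also have "\<dots> = (\<integral>\<^sup>+ y. ennreal (\<phi> y) \<partial>lborel)"
    using assms by (subst nn_integral_density)
      (auto simp: nn_integral_distr dilate_def pos less_imp_le ennreal_power simp flip: ennreal_mult' intro!: nn_integral_cong)
  also have "\<dots> = ennreal 1"
    using integral_one pos by (subst nn_integral_eq_integral)
      (auto simp: has_bochner_integral_iff less_imp_le)
  finally show "(\<integral>\<^sup>+ \<xi>. ennreal (dilate \<phi> t (x - \<xi>)) \<partial>lborel) = ennreal 1" .
qed (use assms in \<open>auto simp: dilate_pos less_imp_le\<close>)

text \<open>The ball of radius \<open>norm y / 4\<close> around \<open>(3/4) y\<close> has volume comparable to
  \<open>norm y ^ DIM('a)\<close>, lies in the complement of the ball of radius \<open>norm y / 2\<close>, and \<open>\<phi> \<ge> \<phi> y\<close>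
  on it; so the decay follows from integrability.\<close>

lemma decay:
  assumes "0 < \<epsilon>"
  obtains R where "0 < R" "\<And>y. R \<le> norm y \<Longrightarrow> norm y ^ DIM('a) * \<phi> y \<le> \<epsilon>"
proof -
  define \<omega> where "\<omega> = measure lborel (ball (0::'a) 1)"
  have \<omega>: "0 < \<omega>" by (simp add: \<omega>_def)
  \<comment> \<open>Chosen so that the tail bound, divided by the volume \<omega> (norm y / 4)^n of
    the ball in dimension n, becomes the claim.\<close>
  define \<eta> where "\<eta> = \<epsilon> * \<omega> / 4 ^ DIM('a)"
  have "0 < \<eta>" using assms \<omega> by (simp add: \<eta>_def)
  have int: "integrable lborel \<phi>" using integral_one by (simp add: has_bochner_integral_iff)
  obtain R0 where R0: "\<And>R. R0 \<le> R \<Longrightarrow>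
      (LINT \<xi>|lborel. indicator {\<xi>. R < norm (0 - \<xi>)} \<xi> * \<phi> \<xi>) < \<eta>"
    using integral_tail_small[OF sets_lborel int \<open>0 < \<eta>\<close>, of 0] by metis
  show ?thesis
  proof (rule that)
    \<comment> \<open>The tail lies outside radius \<open>norm y / 2\<close>, hence
      \<open>2 * R0\<close>; the 1 makes the radius positive.\<close>
    show "0 < max 1 (2 * R0)" by simp
    fix y :: 'a assume y: "max 1 (2 * R0) \<le> norm y"
    let ?B = "ball ((3/4) *\<^sub>R y) (norm y / 4)"
    have B: "norm y / 2 < norm \<xi>" "norm \<xi> \<le> norm y" if "\<xi> \<in> ?B" for \<xi>
    proof -
      have "norm ((3/4) *\<^sub>R y - \<xi>) < norm y / 4"
        using that by (simp add: dist_norm)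
      moreover have "norm ((3/4) *\<^sub>R y) \<le> norm ((3/4) *\<^sub>R y - \<xi>) + norm \<xi>"
        "norm \<xi> \<le> norm ((3/4) *\<^sub>R y) + norm ((3/4) *\<^sub>R y - \<xi>)"
        by norm+
      ultimately show "norm y / 2 < norm \<xi>" "norm \<xi> \<le> norm y" by auto
    qed
    have "\<phi> y * measure lborel ?B = (LINT \<xi>|lborel. indicator ?B \<xi> * \<phi> y)"
      by (simp add: mult.commute)
    also have "\<dots> \<le> (LINT \<xi>|lborel. indicator {\<xi>. norm y / 2 < norm (0 - \<xi>)} \<xi> * \<phi> \<xi>)"
    proof (rule integral_mono)
      show "integrable lborel (\<lambda>\<xi>. indicator ?B \<xi> * \<phi> y)"
        using emeasure_lborel_ball_finite[of "(3/4) *\<^sub>R y" "norm y / 4"]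
        by (intro integrable_mult_left integrable_real_indicator) auto
      show "integrable lborel (\<lambda>\<xi>. indicator {\<xi>. norm y / 2 < norm (0 - \<xi>)} \<xi> * \<phi> \<xi>)"
        by (rule Bochner_Integration.integrable_bound[OF int]) (auto simp: indicator_def)
      show "indicator ?B \<xi> * \<phi> y \<le> indicator {\<xi>. norm y / 2 < norm (0 - \<xi>)} \<xi> * \<phi> \<xi>" for \<xi>
        using B[of \<xi>] mono[of \<xi> y] pos[of \<xi>] by (auto simp: indicator_def)
    qed
    also have "\<dots> < \<eta>" using y by (intro R0) auto
    also have "measure lborel ?B = \<omega> * (norm y ^ DIM('a) / 4 ^ DIM('a))"
      by (simp add: \<omega>_def content_ball power_divide)
    finally show "norm y ^ DIM('a) * \<phi> y \<le> \<epsilon>"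
      using \<omega> by (simp add: \<eta>_def field_simps)
  qed
qed

text \<open>With z = y / t and n the dimension, \<open>dilate \<phi> t y\<close> equals (norm z)^n
  \<phi>(z) / (norm y)^n, and norm z is large for small t.\<close>

lemma dilate_tendsto_0:
  assumes "y \<noteq> 0" "0 < \<epsilon>"
  obtains \<tau> where "0 < \<tau>" "\<And>t. 0 < t \<Longrightarrow> t < \<tau> \<Longrightarrow> dilate \<phi> t y \<le> \<epsilon>"
proof -
  have y: "0 < norm y" using assms by simp
  obtain R where R: "0 < R" "\<And>z. R \<le> norm z \<Longrightarrow> norm z ^ DIM('a) * \<phi> z \<le> \<epsilon> * norm y ^ DIM('a)"
    using decay[of "\<epsilon> * norm y ^ DIM('a)"] assms y by auto
  show ?thesis
  proof (rule that)
    show "0 < norm y / R" using y R by simp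
    fix t assume t: "0 < t" "t < norm y / R"
    then have "norm (y /\<^sub>R t) ^ DIM('a) * \<phi> (y /\<^sub>R t) \<le> \<epsilon> * norm y ^ DIM('a)"
      using R(1) by (intro R(2)) (simp add: field_simps)
    then show "dilate \<phi> t y \<le> \<epsilon>"
      using t y by (simp add: dilate_def power_divide field_simps)
  qed
qed

text \<open>Monotonicity in the distance to \<open>x\<close> makes the set a ball, and lower
  semicontinuity makes it open, matching the open balls of \<open>sigma_point\<close>. The bound
  \<open>dilate \<phi> t y \<le> s\<close> confines its radius.\<close>

lemma superlevel_dilate:
  assumes t: "0 < t" and s: "dilate \<phi> t y \<le> s" and ne: "{\<xi>. s < dilate \<phi> t (x - \<xi>)} \<noteq> {}"
  obtains r where "0 < r" "r \<le> norm y" "{\<xi>. s < dilate \<phi> t (x - \<xi>)} = ball x r"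
proof -
  define U where "U = {\<xi>. s < dilate \<phi> t (x - \<xi>)}"
  have "U = (\<lambda>\<xi>. (x - \<xi>) /\<^sub>R t) -` {z. s * t ^ DIM('a) < \<phi> z}"
    using t by (auto simp: U_def dilate_def field_simps)
  then have "open U"
    using lsc unfolding lower_semicontinuous_def
    by (simp only:) (intro open_vimage continuous_intros, blast)
  have down: "\<zeta> \<in> U" if "\<xi> \<in> U" "norm (x - \<zeta>) \<le> norm (x - \<xi>)" for \<xi> \<zeta>
    using that dilate_mono[OF t that(2)] by (auto simp: U_def)
  have bound: "norm (x - \<xi>) < norm y" if "\<xi> \<in> U" for \<xi>
    using that s dilate_mono[OF t, of y "x - \<xi>"] by (force simp: U_def)
  define r where "r = (SUP \<xi>\<in>U. norm (x - \<xi>))"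
  have bdd: "bdd_above ((\<lambda>\<xi>. norm (x - \<xi>)) ` U)"
    using bound by (auto simp: bdd_above_def intro: less_imp_le)
  have "U \<noteq> {}" using ne by (simp add: U_def)
  \<comment> \<open>The supremum is not attained: openness lets \<xi> be pushed away from
    \<open>x\<close> by \<open>e / 2\<close>.\<close>
  have U_less: "norm (x - \<xi>) < r" if \<xi>: "\<xi> \<in> U" for \<xi>
  proof -
    obtain e where e: "0 < e" "ball \<xi> e \<subseteq> U"
      using \<open>open U\<close> \<xi> openE by blast
    obtain v :: 'a where v: "norm v = 1" using vector_choose_size[of 1] by auto
    \<comment> \<open>Unit vector pointing away from \<open>x\<close>; at \<xi> = x any direction
      will do.\<close>
    define w where "w = (if \<xi> = x then v else (1 / norm (\<xi> - x)) *\<^sub>R (\<xi> - x))"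
    have w: "norm w = 1" "\<xi> - x = norm (x - \<xi>) *\<^sub>R w"
      using v by (auto simp: w_def norm_minus_commute)
    define \<zeta> where "\<zeta> = \<xi> + (e / 2) *\<^sub>R w"
    have "\<zeta> \<in> U" using e w by (intro subsetD[OF e(2)]) (auto simp: \<zeta>_def dist_norm)
    have "\<zeta> - x = (norm (x - \<xi>) + e / 2) *\<^sub>R w"
      unfolding \<zeta>_def scaleR_add_left w(2)[symmetric] by simp
    then have "norm (x - \<zeta>) = norm (x - \<xi>) + e / 2"
      using e w(1) by (simp add: norm_minus_commute[of x \<zeta>])
    moreover have "norm (x - \<zeta>) \<le> r"
      unfolding r_def using bdd \<open>\<zeta> \<in> U\<close> by (intro cSUP_upper) auto
    ultimately show ?thesis using e by simp
  qed
  show ?thesis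
  proof (rule that)
    show "0 < r" using U_less \<open>U \<noteq> {}\<close> norm_ge_zero by (metis ex_in_conv order_le_less_trans)
    show "r \<le> norm y"
      unfolding r_def using \<open>U \<noteq> {}\<close> bound by (intro cSUP_least) (auto intro: less_imp_le)
    show "{\<xi>. s < dilate \<phi> t (x - \<xi>)} = ball x r"
      unfolding U_def[symmetric]
    proof (intro antisym subsetI)
      fix \<zeta> assume "\<zeta> \<in> ball x r"
      then have "norm (x - \<zeta>) < r" by (simp add: dist_norm)
      then obtain \<xi> where "\<xi> \<in> U" "norm (x - \<zeta>) < norm (x - \<xi>)"
        unfolding r_def using \<open>U \<noteq> {}\<close> bdd by (auto simp: less_cSUP_iff)
      then show "\<zeta> \<in> U" using down[of \<xi> \<zeta>] by simp
    qed (use U_less in \<open>auto simp: dist_norm\<close>)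
  qed
qed


section \<open>Near and far parts of the truncated kernel\<close>

text \<open>Nonempty superlevel sets of \<open>g\<close> are balls of radius at most
  \<open>norm y\<close>, so the layer cake formula makes the left side an integral over levels of
  the ball discrepancy. Levels run up to \<open>dilate \<phi> t 0\<close>, which yields the
  \<open>K\<close> term; the \<open>e\<close> term integrates to \<open>e\<close> times the Lebesgue
  integral of \<open>g\<close>, at most 1 as \<open>g\<close> lies below the kernel.\<close>

lemma near_estimate:
  fixes P Q :: "'a measure"
  assumes t: "0 < t" and y: "y \<noteq> 0"
    and P: "sets P = sets borel" "sigma_finite_measure P" "\<And>r. emeasure P (ball x r) < \<infinity>"
    and Q: "sets Q = sets borel" "sigma_finite_measure Q" "\<And>r. emeasure Q (ball x r) < \<infinity>"
    and K: "0 \<le> K" "0 \<le> e"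
    and ball: "\<And>r. 0 < r \<Longrightarrow> r \<le> norm y \<Longrightarrow>
      \<bar>measure P (ball x r) - measure Q (ball x r) - l * measure lborel (ball x r)\<bar> \<le> K + e * measure lborel (ball x r)"
  defines "g \<equiv> \<lambda>\<xi>. max 0 (dilate \<phi> t (x - \<xi>) - dilate \<phi> t y)"
  shows "integrable P g" "integrable Q g" "integrable lborel g"
    "\<bar>(LINT \<xi>|P. g \<xi>) - (LINT \<xi>|Q. g \<xi>) - l * (LINT \<xi>|lborel. g \<xi>)\<bar> \<le> K * dilate \<phi> t 0 + e"
proof -
  let ?f = "\<lambda>\<xi>. dilate \<phi> t (x - \<xi>)"
  have level: "{\<xi>. s < g \<xi>} = {\<xi>. s + dilate \<phi> t y < ?f \<xi>}" if "0 \<le> s" for s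
    using that by (auto simp: g_def)
  have level_ball: "\<exists>r. 0 < r \<and> r \<le> norm y \<and> {\<xi>. s < g \<xi>} = ball x r"
    if "0 \<le> s" "{\<xi>. s < g \<xi>} \<noteq> {}" for s
    using superlevel_dilate[OF t, of y "s + dilate \<phi> t y" x] that unfolding level[OF that(1)] by auto
  have g0: "0 \<le> g \<xi>" for \<xi> by (simp add: g_def)
  have f_le: "?f \<xi> \<le> dilate \<phi> t 0" for \<xi> using t by (intro dilate_mono) auto
  have g_le: "g \<xi> \<le> dilate \<phi> t 0" for \<xi>
    using f_le[of \<xi>] dilate_pos[OF t, of y] dilate_pos[OF t, of 0] by (simp add: g_def)
  have [measurable]: "g \<in> borel_measurable borel" unfolding g_def by measurable
  have *: "integrable M g" "has_bochner_integral lborel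
    (\<lambda>s. indicator {0..} s * measure M {\<xi>. s < g \<xi>}) (LINT \<xi>|M. g \<xi>)"
    if M: "sets M = sets borel" "sigma_finite_measure M" "\<And>r. emeasure M (ball x r) < \<infinity>" for M
  proof -
    have sp: "space M = UNIV" using sets_eq_imp_space_eq[OF M(1)] by simp
    have fin: "emeasure M {\<xi>. 0 < g \<xi>} < \<infinity>"
      using level_ball[of 0] M(3) by (cases "{\<xi>. 0 < g \<xi>} = {}") auto
    note [measurable_cong] = M(1)
    show int: "integrable M g"
    proof (rule Bochner_Integration.integrable_bound)
      show "integrable M (\<lambda>\<xi>. indicator {\<xi>. 0 < g \<xi>} \<xi> * dilate \<phi> t 0)"
        using fin M(1) by (intro integrable_mult_left integrable_real_indicator) auto
      show "AE \<xi> in M. norm (g \<xi>) \<le> norm (indicator {\<xi>. 0 < g \<xi>} \<xi> * dilate \<phi> t 0)"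
        using g_le g0 by (intro AE_I2) (auto simp: indicator_def not_less intro: order_trans[OF _ abs_ge_self])
    qed measurable
    show "has_bochner_integral lborel
      (\<lambda>s. indicator {0..} s * measure M {\<xi>. s < g \<xi>}) (LINT \<xi>|M. g \<xi>)"
      using has_bochner_integral_layer_cake[OF M(2) int g0] fin by (simp add: sp)
  qed
  have lb: "sigma_finite_measure (lborel :: 'a measure)" "\<And>r. emeasure lborel (ball x r) < \<infinity>"
    using emeasure_lborel_ball_finite[of x] by (auto intro: lborel.sigma_finite_measure_axioms)
  show intP: "integrable P g" by (rule *(1)[OF P])
  show intQ: "integrable Q g" by (rule *(1)[OF Q])
  show intL: "integrable lborel g" by (rule *(1)[OF sets_lborel lb])
  define p where "p M s = indicator {0..} s * measure M {\<xi>. s < g \<xi>}" for M :: "'a measure" and s :: real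
  have pP: "has_bochner_integral lborel (p P) (LINT \<xi>|P. g \<xi>)"
    and pQ: "has_bochner_integral lborel (p Q) (LINT \<xi>|Q. g \<xi>)"
    and pL: "has_bochner_integral lborel (p lborel) (LINT \<xi>|lborel. g \<xi>)"
    unfolding p_def by (rule *(2)[OF P] *(2)[OF Q] *(2)[OF sets_lborel lb])+
  have lhs: "has_bochner_integral lborel (\<lambda>s. p P s - p Q s - l * p lborel s)
    ((LINT \<xi>|P. g \<xi>) - (LINT \<xi>|Q. g \<xi>) - l * (LINT \<xi>|lborel. g \<xi>))"
    by (intro has_bochner_integral_diff has_bochner_integral_mult_right pP pQ pL)
  have "has_bochner_integral lborel (indicator {0..dilate \<phi> t 0}) (measure lborel {0..dilate \<phi> t 0})"
    by (intro has_bochner_integral_real_indicator) (auto simp: emeasure_lborel_Icc_eq)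
  then have "has_bochner_integral lborel (indicator {0..dilate \<phi> t 0}) (dilate \<phi> t 0)"
    using dilate_pos[OF t, of 0] by simp
  then have rhs: "has_bochner_integral lborel (\<lambda>s. K * indicator {0..dilate \<phi> t 0} s + e * p lborel s)
    (K * dilate \<phi> t 0 + e * (LINT \<xi>|lborel. g \<xi>))"
    by (intro has_bochner_integral_add has_bochner_integral_mult_right pL)
  have le: "norm (p P s - p Q s - l * p lborel s) \<le> K * indicator {0..dilate \<phi> t 0} s + e * p lborel s" for s
  proof (cases "0 \<le> s \<and> {\<xi>. s < g \<xi>} \<noteq> {}")
    case True
    then have s: "0 \<le> s" "s \<le> dilate \<phi> t 0" using g_le by (auto intro: order_trans less_imp_le)
    obtain r where "0 < r" "r \<le> norm y" "{\<xi>. s < g \<xi>} = ball x r"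
      using level_ball True by blast
    then show ?thesis using ball[of r] s by (simp add: p_def)
  next
    case False
    then have "p M s = 0" for M by (auto simp: p_def)
    then show ?thesis using K by simp
  qed
  have "norm (LINT s|lborel. p P s - p Q s - l * p lborel s) \<le>
    (LINT s|lborel. K * indicator {0..dilate \<phi> t 0} s + e * p lborel s)"
    by (rule Bochner_Integration.integral_norm_bound_integral[OF integrable.intros[OF lhs] integrable.intros[OF rhs] le])
  moreover have "e * (LINT \<xi>|lborel. g \<xi>) \<le> e"
  proof -
    have "(LINT \<xi>|lborel. g \<xi>) \<le> (LINT \<xi>|lborel. ?f \<xi>)"
      using intL integral_dilate[OF t, of x] dilate_pos[OF t]
      by (intro integral_mono) (auto simp: has_bochner_integral_iff g_def less_imp_le)
    also have "\<dots> = 1" using integral_dilate[OF t, of x] by (simp add: has_bochner_integral_iff)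
    finally show ?thesis using K(2) by (simp add: mult_left_le)
  qed
  ultimately show "\<bar>(LINT \<xi>|P. g \<xi>) - (LINT \<xi>|Q. g \<xi>) - l * (LINT \<xi>|lborel. g \<xi>)\<bar> \<le> K * dilate \<phi> t 0 + e"
    using lhs rhs by (simp add: has_bochner_integral_iff)
qed

text \<open>On a large closed ball around \<open>x1\<close> the truncation level tends to 0 while
  the mass is finite; outside, the comparison condition dominates the kernel by \<open>C\<close>
  times the integrable one at \<open>t0\<close>, whose tail is small. The bound \<tau> is uniform
  over \<open>x\<close> within 1 of \<open>x0\<close>.\<close>

lemma far_estimate:
  fixes M :: "'a measure"
  assumes M: "sets M = sets borel" "\<And>r. emeasure M (cball x1 r) < \<infinity>"
    and comp: "comparison_condition \<phi>"
    and t0: "0 < t0" and int: "integrable M (\<lambda>\<xi>. dilate \<phi> t0 (x1 - \<xi>))"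
    and y: "y \<noteq> 0" and \<eta>: "0 < \<eta>"
  obtains \<tau> where "0 < \<tau>" "\<And>t x. 0 < t \<Longrightarrow> t < \<tau> \<Longrightarrow> norm (x - x0) < 1 \<Longrightarrow>
    integrable M (\<lambda>\<xi>. min (dilate \<phi> t (x - \<xi>)) (dilate \<phi> t y)) \<and>
    (LINT \<xi>|M. min (dilate \<phi> t (x - \<xi>)) (dilate \<phi> t y)) \<le> \<eta>"
proof -
  note [measurable_cong] = M(1)
  obtain C0 where C0: "\<And>t x. 0 < t \<Longrightarrow> t < 1 \<Longrightarrow> 1 < norm x \<Longrightarrow> dilate \<phi> t x / \<phi> x \<le> C0"
    using comp unfolding comparison_condition_def bdd_above_def by blast
  \<comment> \<open>The power of 2 pays for halving \<open>w\<close> below; \<open>max C0 1\<close>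
    makes the constant positive.\<close>
  define C where "C = 2 ^ DIM('a) * max C0 1"
  have "0 < C" by (simp add: C_def)
  \<comment> \<open>Monotonicity replaces \<open>z\<close> by half of \<open>w\<close>. Rescaling by
    \<open>t0\<close> then leads to the dilation parameter \<open>2 * t / t0 < 1\<close> at a point
    of norm above 1, where the comparison condition applies.\<close>
  have C: "dilate \<phi> t z \<le> C * dilate \<phi> t0 w"
    if "0 < t" "2 * t < t0" "t0 < norm w" "norm w \<le> 2 * norm z" for t z w
  proof -
    have "dilate \<phi> t z \<le> dilate \<phi> t (w /\<^sub>R 2)"
      using that by (intro dilate_mono) auto
    also have "\<dots> = 2 ^ DIM('a) * (dilate \<phi> (2 * t / t0) (w /\<^sub>R t0) / t0 ^ DIM('a))"
      using t0 that(1) by (simp add: dilate_def power_divide power_mult_distrib field_simps)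
    also have "dilate \<phi> (2 * t / t0) (w /\<^sub>R t0) \<le> max C0 1 * \<phi> (w /\<^sub>R t0)"
    proof -
      have "dilate \<phi> (2 * t / t0) (w /\<^sub>R t0) / \<phi> (w /\<^sub>R t0) \<le> max C0 1"
        using C0[of "2 * t / t0" "w /\<^sub>R t0"] that t0 by (simp add: field_simps le_max_iff_disj)
      then show ?thesis using pos by (simp add: pos_divide_le_eq)
    qed
    finally show ?thesis
      using t0 by (simp add: C_def dilate_def divide_right_mono mult.assoc)
  qed
  define F where "F = (\<lambda>\<xi>. dilate \<phi> t0 (x1 - \<xi>))"
  have [measurable]: "F \<in> borel_measurable borel" unfolding F_def by measurable
  have F: "integrable M F" "\<And>\<xi>. 0 \<le> F \<xi>"
    using int t0 by (auto simp: F_def dilate_pos less_imp_le)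
  have "0 < \<eta> / (2 * C)" using \<eta> \<open>0 < C\<close> by simp
  then obtain R0 where R0: "\<And>R. R0 \<le> R \<Longrightarrow>
      (LINT \<xi>|M. indicator {\<xi>. R < norm (x1 - \<xi>)} \<xi> * F \<xi>) < \<eta> / (2 * C)"
    using integral_tail_small[OF M(1) F(1)] by blast
  \<comment> \<open>\<open>R0\<close> makes the tail small and \<open>t0\<close> puts the far points
    in the range of the comparison. The last entry gives
    \<open>norm (x1 - \<xi>) \<le> 2 * norm (x - \<xi>)\<close> there, since moving the centre costs
    at most \<open>R / 2\<close>.\<close>
  define R where "R = Max {R0, t0, 2 * (norm (x0 - x1) + 1)}"
  have R: "R0 \<le> R" "t0 \<le> R" "2 * (norm (x0 - x1) + 1) \<le> R" by (auto simp: R_def)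
  define m where "m = measure M (cball x1 R)"
  \<comment> \<open>Adding 1 avoids dividing by 0 when the ball has no mass.\<close>
  have "0 < m + 1" by (simp add: m_def add_nonneg_pos)
  then have "0 < \<eta> / 2 / (m + 1)" using \<eta> by simp
  then obtain \<tau> where \<tau>: "0 < \<tau>" "\<And>t. 0 < t \<Longrightarrow> t < \<tau> \<Longrightarrow> dilate \<phi> t y \<le> \<eta> / 2 / (m + 1)"
    using dilate_tendsto_0[OF y] by metis
  show ?thesis
  proof (rule that)
    show "0 < min \<tau> (t0 / 2)" using \<tau> t0 by simp
    fix t x assume t: "0 < t" "t < min \<tau> (t0 / 2)" and x: "norm (x - x0) < 1"
    define c where "c = dilate \<phi> t y"
    define h where "h = (\<lambda>\<xi>. min (dilate \<phi> t (x - \<xi>)) c)"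
    define H where "H = (\<lambda>\<xi>. c * indicator (cball x1 R) \<xi> + C * (indicator {\<xi>. R < norm (x1 - \<xi>)} \<xi> * F \<xi>))"
    have c: "0 < c" "c \<le> \<eta> / 2 / (m + 1)" using t \<tau> by (auto simp: c_def dilate_pos)
    have h0: "0 \<le> h \<xi>" for \<xi> using c t by (simp add: h_def dilate_pos less_imp_le)
    have hH: "h \<xi> \<le> H \<xi>" for \<xi>
    proof (cases "\<xi> \<in> cball x1 R")
      case True
      then show ?thesis by (auto simp: h_def H_def dist_norm)
    next
      case False
      then have \<xi>: "R < norm (x1 - \<xi>)" by (simp add: dist_norm)
      have "norm (x1 - \<xi>) \<le> norm (x - \<xi>) + norm (x - x0) + norm (x0 - x1)" by norm
      then have "norm (x1 - \<xi>) \<le> 2 * norm (x - \<xi>)" using \<xi> x R(3) unfolding distrib_left by simp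
      then have "dilate \<phi> t (x - \<xi>) \<le> C * F \<xi>"
        unfolding F_def using t \<xi> R(2) by (intro C) auto
      then show ?thesis using \<xi> False by (auto simp: h_def H_def)
    qed
    have tail: "integrable M (\<lambda>\<xi>. indicator {\<xi>. R < norm (x1 - \<xi>)} \<xi> * F \<xi>)"
      by (rule Bochner_Integration.integrable_bound[OF F(1)]) (auto simp: indicator_def)
    have cb: "integrable M (indicator (cball x1 R) :: 'a \<Rightarrow> real)"
      using M by (intro integrable_real_indicator) auto
    have H: "integrable M H"
      unfolding H_def using tail cb by auto
    have h: "integrable M h"
    proof (rule Bochner_Integration.integrable_bound[OF H])
      show "h \<in> borel_measurable M" unfolding h_def by measurable
      show "AE \<xi> in M. norm (h \<xi>) \<le> norm (H \<xi>)"
        using h0 hH by (intro AE_I2) (auto intro: order_trans[OF _ abs_ge_self])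
    qed
    have "(LINT \<xi>|M. h \<xi>) \<le> (LINT \<xi>|M. H \<xi>)"
      using h H hH by (intro integral_mono)
    also have "\<dots> = c * m + C * (LINT \<xi>|M. indicator {\<xi>. R < norm (x1 - \<xi>)} \<xi> * F \<xi>)"
      unfolding H_def m_def using tail cb M(1) sets_eq_imp_space_eq[OF M(1)]
      by (subst Bochner_Integration.integral_add) auto
    also have "\<dots> \<le> \<eta> / 2 + \<eta> / 2"
    proof (rule add_mono)
      have "c * m \<le> c * (m + 1)" using c(1) by simp
      also have "\<dots> \<le> \<eta> / 2" using c(2) \<open>0 < m + 1\<close> by (simp only: pos_le_divide_eq)
      finally show "c * m \<le> \<eta> / 2" .
      show "C * (LINT \<xi>|M. indicator {\<xi>. R < norm (x1 - \<xi>)} \<xi> * F \<xi>) \<le> \<eta> / 2"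
        using R0[OF R(1)] \<open>0 < C\<close> by (simp add: field_simps)
    qed
    finally show "integrable M (\<lambda>\<xi>. min (dilate \<phi> t (x - \<xi>)) (dilate \<phi> t y)) \<and>
      (LINT \<xi>|M. min (dilate \<phi> t (x - \<xi>)) (dilate \<phi> t y)) \<le> \<eta>"
      using h by (simp add: h_def c_def)
  qed
qed

section \<open>Passage to the nontangential limit\<close>

text \<open>Each integral is split into its near and far part. Since the kernel has Lebesgue
  integral 1, \<open>l\<close> is split too, so the far part is estimated for Lebesgue measure as
  well as for \<open>P\<close> and \<open>Q\<close>.\<close>

lemma convolution_difference_tendsto:
  fixes P Q :: "'a measure"
  assumes P: "sets P = sets borel" "\<And>x r. emeasure P (cball x r) < \<infinity>"
    and Q: "sets Q = sets borel" "\<And>x r. emeasure Q (cball x r) < \<infinity>"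
    and comp: "comparison_condition \<phi>"
    and t0: "0 < t0"
    and intP: "integrable P (\<lambda>\<xi>. dilate \<phi> t0 (x1 - \<xi>))"
    and intQ: "integrable Q (\<lambda>\<xi>. dilate \<phi> t0 (x1 - \<xi>))"
    and sigma: "\<And>\<epsilon>. 0 < \<epsilon> \<Longrightarrow> \<exists>\<delta>>0. \<forall>x r. norm (x - x0) < \<delta> \<longrightarrow> 0 < r \<longrightarrow> r < \<delta> \<longrightarrow>
      \<bar>measure P (ball x r) - measure Q (ball x r) - l * measure lborel (ball x r)\<bar>
        < \<epsilon> * (norm (x - x0) + r) ^ DIM('a)"
    and \<alpha>: "0 < \<alpha>" and \<eta>: "0 < \<eta>"
  obtains \<tau> where "0 < \<tau>" "\<And>t x. 0 < t \<Longrightarrow> t < \<tau> \<Longrightarrow> norm (x - x0) < \<alpha> * t \<Longrightarrow>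
    \<bar>(LINT \<xi>|P. dilate \<phi> t (x - \<xi>)) - (LINT \<xi>|Q. dilate \<phi> t (x - \<xi>)) - l\<bar> < \<eta>"
proof -
  define n where "n = DIM('a)"
  define \<omega> where "\<omega> = unit_ball_vol (real n)"
  have \<omega>: "0 < \<omega>" by (simp add: \<omega>_def unit_ball_vol_pos)
  \<comment> \<open>\<open>\<epsilon> * B\<close> will be the total near error: in the cone the
    displacement of \<open>x\<close> is below \<open>\<alpha> * t\<close>, and \<open>t ^ n\<close>
    cancels against \<open>dilate \<phi> t 0\<close>. The choice of \<epsilon> makes it
    \<open>\<eta> / 4\<close>.\<close>
  define B where "B = 2 ^ n * (\<alpha> ^ n * \<phi> 0 + 1 / \<omega>)"
  have B: "0 < B" using \<omega> \<alpha> pos[of 0] by (simp add: B_def add_pos_pos)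
  define \<epsilon> where "\<epsilon> = \<eta> / (4 * B)"
  have \<epsilon>: "0 < \<epsilon>" using \<eta> B by (simp add: \<epsilon>_def)
  obtain \<delta> where \<delta>: "0 < \<delta>" "\<And>x r. norm (x - x0) < \<delta> \<Longrightarrow> 0 < r \<Longrightarrow> r < \<delta> \<Longrightarrow>
      \<bar>measure P (ball x r) - measure Q (ball x r) - l * measure lborel (ball x r)\<bar>
        < \<epsilon> * (norm (x - x0) + r) ^ n"
    using sigma[OF \<epsilon>] unfolding n_def by blast
  \<comment> \<open>\<open>y\<close> serves to fix the truncation distance; its norm keeps all radii
    below \<delta>.\<close>
  obtain y :: 'a where y: "norm y = \<delta> / 2" using vector_choose_size[of "\<delta> / 2"] \<delta>(1) by auto
  then have "y \<noteq> 0" using \<delta>(1) by auto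
  \<comment> \<open>The far errors under \<open>P\<close>, \<open>Q\<close> and \<open>l\<close>
    times Lebesgue measure add up to at most \<open>(2 + \<bar>l\<bar>) * \<zeta>\<close>, another
    \<open>\<eta> / 4\<close>.\<close>
  define \<zeta> where "\<zeta> = \<eta> / (4 * (2 + \<bar>l\<bar>))"
  have \<zeta>: "0 < \<zeta>" using \<eta> by (simp add: \<zeta>_def add_pos_nonneg)
  let ?f = "\<lambda>t x \<xi>. dilate \<phi> t (x - \<xi>)"
  let ?g = "\<lambda>t x \<xi>. max 0 (?f t x \<xi> - dilate \<phi> t y)"
  let ?h = "\<lambda>t x \<xi>. min (?f t x \<xi>) (dilate \<phi> t y)"
  have far: "\<exists>\<tau>>0. \<forall>t x. 0 < t \<longrightarrow> t < \<tau> \<longrightarrow> norm (x - x0) < 1 \<longrightarrow>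
      integrable M (?h t x) \<and> (LINT \<xi>|M. ?h t x \<xi>) \<le> \<zeta>"
    if "sets M = sets borel" "\<And>x r. emeasure M (cball x r) < \<infinity>" "integrable M (?f t0 x1)" for M
    using far_estimate[OF that(1,2) comp t0 that(3) \<open>y \<noteq> 0\<close> \<zeta>, of x0] by metis
  have L: "emeasure lborel (cball x r) < \<infinity>" for x :: 'a and r
    using emeasure_lborel_cball_finite by auto
  have intL: "integrable lborel (?f t0 x1)"
    using integral_dilate[OF t0] by (simp add: has_bochner_integral_iff)
  obtain \<tau>P where \<tau>P: "0 < \<tau>P" "\<And>t x. 0 < t \<Longrightarrow> t < \<tau>P \<Longrightarrow> norm (x - x0) < 1 \<Longrightarrow>
      integrable P (?h t x) \<and> (LINT \<xi>|P. ?h t x \<xi>) \<le> \<zeta>"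
    using far[OF P intP] by blast
  obtain \<tau>Q where \<tau>Q: "0 < \<tau>Q" "\<And>t x. 0 < t \<Longrightarrow> t < \<tau>Q \<Longrightarrow> norm (x - x0) < 1 \<Longrightarrow>
      integrable Q (?h t x) \<and> (LINT \<xi>|Q. ?h t x \<xi>) \<le> \<zeta>"
    using far[OF Q intQ] by blast
  obtain \<tau>L where \<tau>L: "0 < \<tau>L" "\<And>t x. 0 < t \<Longrightarrow> t < \<tau>L \<Longrightarrow> norm (x - x0) < 1 \<Longrightarrow>
      integrable lborel (?h t x) \<and> (LINT \<xi>|lborel. ?h t x \<xi>) \<le> \<zeta>"
    using far[OF sets_lborel L intL] by blast
  show ?thesis
  proof (rule that)
    \<comment> \<open>\<open>1 / \<alpha>\<close> and \<open>\<delta> / \<alpha>\<close> turn the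
      cone condition into distance from \<open>x0\<close> below 1 and below \<delta>.\<close>
    show "0 < Min {\<tau>P, \<tau>Q, \<tau>L, 1 / \<alpha>, \<delta> / \<alpha>}"
      using \<tau>P \<tau>Q \<tau>L \<alpha> \<delta> by simp
    fix t x assume t: "0 < t" "t < Min {\<tau>P, \<tau>Q, \<tau>L, 1 / \<alpha>, \<delta> / \<alpha>}" and x: "norm (x - x0) < \<alpha> * t"
    then have t': "t < \<tau>P" "t < \<tau>Q" "t < \<tau>L" "\<alpha> * t < 1" "\<alpha> * t < \<delta>"
      using \<alpha> by (simp_all add: field_simps)
    have x': "norm (x - x0) < 1" "norm (x - x0) < \<delta>" using x t' by auto
    have ball: "\<bar>measure P (ball x r) - measure Q (ball x r) - l * measure lborel (ball x r)\<bar> \<le>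
        \<epsilon> * 2 ^ n * (\<alpha> * t) ^ n + \<epsilon> * 2 ^ n / \<omega> * measure lborel (ball x r)"
      if r: "0 < r" "r \<le> norm y" for r
    proof -
      \<comment> \<open>The power of the sum is split via the maximum and \<open>r ^ n\<close>
        converted to volume, giving the shape \<open>near_estimate\<close> expects: a constant from
        the displacement plus a multiple of the volume.\<close>
      have "(norm (x - x0) + r) ^ n \<le> (2 * max (\<alpha> * t) r) ^ n"
        using x r by (intro power_mono) auto
      also have "\<dots> \<le> 2 ^ n * ((\<alpha> * t) ^ n + r ^ n)"
        using r \<alpha> t by (simp add: power_mult_distrib max_def)
      also have "r ^ n = measure lborel (ball x r) / \<omega>"
      proof -
        have "measure lborel (ball x r) = \<omega> * r ^ n"
          using r by (simp add: content_ball \<omega>_def n_def)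
        then show ?thesis using \<omega> by simp
      qed
      finally have "\<epsilon> * (norm (x - x0) + r) ^ n \<le>
          \<epsilon> * (2 ^ n * ((\<alpha> * t) ^ n + measure lborel (ball x r) / \<omega>))"
        using \<epsilon> by simp
      moreover have "r < \<delta>" using r y \<delta>(1) by simp
      ultimately show ?thesis
        using \<delta>(2)[OF x'(2) r(1)] by (simp add: algebra_simps)
    qed
    have fin: "sigma_finite_measure M" "emeasure M (ball x r) < \<infinity>"
      if "sets M = sets borel" "\<And>x r. emeasure M (cball x r) < \<infinity>" for M :: "'a measure" and x r
    proof -
      have "emeasure M (ball x r) < \<infinity>" for x r
        using emeasure_mono[OF ball_subset_cball[of x r], of M] that by (auto intro: le_less_trans)
      then show "sigma_finite_measure M" "emeasure M (ball x r) < \<infinity>"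
        using that(1) by (auto intro: sigma_finite_if_finite_on_balls)
    qed
    have K: "0 \<le> \<epsilon> * 2 ^ n * (\<alpha> * t) ^ n" "0 \<le> \<epsilon> * 2 ^ n / \<omega>"
      using \<epsilon> \<alpha> t \<omega> by auto
    note near = near_estimate[OF t(1) \<open>y \<noteq> 0\<close> P(1) fin(1)[OF P] fin(2)[OF P] Q(1) fin(1)[OF Q] fin(2)[OF Q] K ball]
    have split: "(LINT \<xi>|M. ?f t x \<xi>) = (LINT \<xi>|M. ?g t x \<xi>) + (LINT \<xi>|M. ?h t x \<xi>)"
      "0 \<le> (LINT \<xi>|M. ?h t x \<xi>)"
      if "integrable M (?g t x)" "integrable M (?h t x)" for M
    proof -
      have "(LINT \<xi>|M. ?f t x \<xi>) = (LINT \<xi>|M. ?g t x \<xi> + ?h t x \<xi>)"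
        by (intro Bochner_Integration.integral_cong) auto
      then show "(LINT \<xi>|M. ?f t x \<xi>) = (LINT \<xi>|M. ?g t x \<xi>) + (LINT \<xi>|M. ?h t x \<xi>)"
        using that by simp
      show "0 \<le> (LINT \<xi>|M. ?h t x \<xi>)"
        using dilate_pos[OF t(1)] by (intro Bochner_Integration.integral_nonneg) (auto simp: less_imp_le)
    qed
    note hP = \<tau>P(2)[OF t(1) t'(1) x'(1)] and hQ = \<tau>Q(2)[OF t(1) t'(2) x'(1)]
      and hL = \<tau>L(2)[OF t(1) t'(3) x'(1)]
    note sP = split[OF near(1) conjunct1[OF hP]] and sQ = split[OF near(2) conjunct1[OF hQ]]
      and sL = split[OF near(3) conjunct1[OF hL]]
    have "(LINT \<xi>|lborel. ?f t x \<xi>) = 1"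
      using integral_dilate[OF t(1), of x] by (simp add: has_bochner_integral_iff)
    then have "l = l * (LINT \<xi>|lborel. ?g t x \<xi>) + l * (LINT \<xi>|lborel. ?h t x \<xi>)"
      using sL(1) by (simp flip: distrib_left)
    then have "\<bar>(LINT \<xi>|P. ?f t x \<xi>) - (LINT \<xi>|Q. ?f t x \<xi>) - l\<bar> \<le>
        \<bar>(LINT \<xi>|P. ?g t x \<xi>) - (LINT \<xi>|Q. ?g t x \<xi>) - l * (LINT \<xi>|lborel. ?g t x \<xi>)\<bar> +
        ((LINT \<xi>|P. ?h t x \<xi>) + (LINT \<xi>|Q. ?h t x \<xi>) + \<bar>l * (LINT \<xi>|lborel. ?h t x \<xi>)\<bar>)"
      using sP sQ by linarith
    also have "\<dots> \<le> (\<epsilon> * 2 ^ n * (\<alpha> * t) ^ n * dilate \<phi> t 0 + \<epsilon> * 2 ^ n / \<omega>) + (\<zeta> + \<zeta> + \<bar>l\<bar> * \<zeta>)"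
      using near(4) hP hQ hL sL(2) by (intro add_mono) (auto simp: abs_mult intro: mult_left_mono)
    also have "\<epsilon> * 2 ^ n * (\<alpha> * t) ^ n * dilate \<phi> t 0 + \<epsilon> * 2 ^ n / \<omega> = \<epsilon> * B"
      using t(1) by (simp add: dilate_def B_def n_def power_mult_distrib field_simps)
    also have "\<epsilon> * B = \<eta> / 4" using B by (simp add: \<epsilon>_def)
    also have "\<zeta> + \<zeta> + \<bar>l\<bar> * \<zeta> = \<zeta> * (2 + \<bar>l\<bar>)" by (simp add: algebra_simps)
    also have "\<dots> = \<eta> / 4" using abs_ge_zero[of l] by (simp add: \<zeta>_def field_simps)
    finally show "\<bar>(LINT \<xi>|P. ?f t x \<xi>) - (LINT \<xi>|Q. ?f t x \<xi>) - l\<bar> < \<eta>"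
      using \<eta> by simp
  qed
qed

text \<open>\<open>P\<close> and \<open>Q\<close> become the two variations of \<nu>, whose
  difference on balls is \<nu>. Domination by the total variation supplies their local finiteness
  and the integrability of the kernel at \<open>t0\<close>; the absolute value in the bound serves
  both signs.\<close>

lemma signed_convolution_tendsto:
  fixes \<mu> :: "'a set \<Rightarrow> complex" and \<nu> :: "'a set \<Rightarrow> real"
  assumes \<mu>: "complex_borel_measure \<mu>"
    and \<nu>: "locally_additive \<nu>" "\<And>A. \<bar>\<nu> A\<bar> \<le> norm (\<mu> A)"
    and comp: "comparison_condition \<phi>"
    and t0: "0 < t0" "abs_convolution \<phi> \<mu> x1 t0 < \<infinity>"
    and sigma: "\<And>\<epsilon>. 0 < \<epsilon> \<Longrightarrow> \<exists>\<delta>>0. \<forall>x r. norm (x - x0) < \<delta> \<longrightarrow> 0 < r \<longrightarrow> r < \<delta> \<longrightarrow>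
      \<bar>\<nu> (ball x r) - l * measure lborel (ball x r)\<bar> < \<epsilon> * (norm (x - x0) + r) ^ DIM('a)"
    and \<alpha>: "0 < \<alpha>"
  shows "((\<lambda>(x, t). signed_integral \<nu> (\<lambda>\<xi>. dilate \<phi> t (x - \<xi>))) \<longlongrightarrow> l)
    (at (x0, 0) within nontangential_cone x0 \<alpha>)"
proof -
  let ?P = "upper_variation \<nu>" and ?Q = "upper_variation (\<lambda>A. - \<nu> A)"
  have \<mu>': "locally_additive \<mu>" and fin: "\<And>K. compact K \<Longrightarrow> emeasure (total_variation \<mu>) K < \<infinity>"
    using \<mu> unfolding complex_borel_measure_def locally_additive_def by blast+
  have \<nu>': "locally_additive (\<lambda>A. - \<nu> A)"
    using \<nu> unfolding locally_additive_def by (auto intro: sums_minus)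
  have *: "emeasure (upper_variation \<kappa>) (cball x r) < \<infinity>"
    "integrable (upper_variation \<kappa>) (\<lambda>\<xi>. dilate \<phi> t0 (x1 - \<xi>))"
    if \<kappa>: "locally_additive \<kappa>" "\<And>A. \<kappa> A \<le> norm (\<mu> A)" for \<kappa> :: "'a set \<Rightarrow> real" and x r
  proof -
    note le = upper_variation_le_total_variation[OF \<mu>' \<kappa>]
    show "emeasure (upper_variation \<kappa>) (cball x r) < \<infinity>"
      using le[of "cball x r"] fin[of "cball x r"] by (auto intro: le_less_trans)
    \<comment> \<open>The order on measures compares all sets; non-Borel ones have
      \<open>emeasure\<close> 0 by default.\<close>
    have "upper_variation \<kappa> \<le> total_variation \<mu>"
      unfolding le_measure_iff using le by (auto simp: le_fun_def) (metis emeasure_notin_sets sets_upper_variation zero_le)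
    then have "(\<integral>\<^sup>+ \<xi>. ennreal (dilate \<phi> t0 (x1 - \<xi>)) \<partial>upper_variation \<kappa>) \<le> abs_convolution \<phi> \<mu> x1 t0"
      unfolding abs_convolution_def by (intro nn_integral_mono_measure) auto
    then show "integrable (upper_variation \<kappa>) (\<lambda>\<xi>. dilate \<phi> t0 (x1 - \<xi>))"
      using t0 by (intro integrableI_nonneg) (auto simp: dilate_pos less_imp_le intro: le_less_trans)
  qed
  have P: "\<nu> A \<le> norm (\<mu> A)" and Q: "- \<nu> A \<le> norm (\<mu> A)" for A
    using \<nu>(2)[of A] by auto
  have diff: "measure ?P (ball x r) - measure ?Q (ball x r) = \<nu> (ball x r)" for x r
  proof (rule upper_variation_diff[OF \<nu>(1)])
    show "emeasure ?P (ball x r) < \<infinity>" "emeasure ?Q (ball x r) < \<infinity>"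
      using *(1)[OF \<nu>(1) P, of x r] *(1)[OF \<nu>' Q, of x r]
        emeasure_mono[OF ball_subset_cball[of x r], of ?P] emeasure_mono[OF ball_subset_cball[of x r], of ?Q]
      by (auto intro: le_less_trans)
  qed auto
  have sigma': "\<exists>\<delta>>0. \<forall>x r. norm (x - x0) < \<delta> \<longrightarrow> 0 < r \<longrightarrow> r < \<delta> \<longrightarrow>
      \<bar>measure ?P (ball x r) - measure ?Q (ball x r) - l * measure lborel (ball x r)\<bar>
        < \<epsilon> * (norm (x - x0) + r) ^ DIM('a)" if "0 < \<epsilon>" for \<epsilon>
    using sigma[OF that] unfolding diff .
  show ?thesis
    unfolding tendsto_iff
  proof (intro allI impI)
    fix \<eta> :: real assume "0 < \<eta>"
    obtain \<tau> where \<tau>: "0 < \<tau>" "\<And>t x. 0 < t \<Longrightarrow> t < \<tau> \<Longrightarrow> norm (x - x0) < \<alpha> * t \<Longrightarrow>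
        \<bar>(LINT \<xi>|?P. dilate \<phi> t (x - \<xi>)) - (LINT \<xi>|?Q. dilate \<phi> t (x - \<xi>)) - l\<bar> < \<eta>"
      using convolution_difference_tendsto[OF sets_upper_variation *(1)[OF \<nu>(1) P]
          sets_upper_variation *(1)[OF \<nu>' Q] comp t0(1) *(2)[OF \<nu>(1) P] *(2)[OF \<nu>' Q]
          sigma' \<alpha> \<open>0 < \<eta>\<close>]
      by blast
    show "\<forall>\<^sub>F p in at (x0, 0) within nontangential_cone x0 \<alpha>.
        dist (case p of (x, t) \<Rightarrow> signed_integral \<nu> (\<lambda>\<xi>. dilate \<phi> t (x - \<xi>))) l < \<eta>"
      unfolding eventually_at
    proof (intro exI conjI ballI impI)
      fix p assume p: "p \<in> nontangential_cone x0 \<alpha>" "p \<noteq> (x0, 0) \<and> dist p (x0, 0) < \<tau>"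
      obtain x t where xt: "p = (x, t)" by (cases p)
      \<comment> \<open>Nearness to the vertex bounds \<open>t\<close>; membership in the cone then
        controls \<open>x\<close>.\<close>
      have "0 < t" "norm (x - x0) < \<alpha> * t" "t < \<tau>"
        using p dist_snd_le[of p "(x0, 0)"] by (auto simp: xt nontangential_cone_def)
      then show "dist (case p of (x, t) \<Rightarrow> signed_integral \<nu> (\<lambda>\<xi>. dilate \<phi> t (x - \<xi>))) l < \<eta>"
        using \<tau>(2)[of t x] by (simp add: xt signed_integral_def dist_real_def)
    qed (use \<tau> in auto)
  qed
qed

end

section \<open>Reduction to real and imaginary parts\<close>

theorem theorem2p10:
  fixes \<phi> :: "real ^ 'n \<Rightarrow> real"
    and \<mu> :: "(real ^ 'n) set \<Rightarrow> complex"
    and x0 x1 :: "real ^ 'n"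
    and t0 :: real
    and L :: complex
  assumes "\<And>x. 0 < \<phi> x"
    and "radial \<phi>"
    and "radially_decreasing \<phi>"
    and "lower_semicontinuous \<phi>"
    and "has_bochner_integral lborel \<phi> 1"
    and "comparison_condition \<phi>"
    and "complex_borel_measure \<mu>"
    and "0 < t0"
    and "abs_convolution \<phi> \<mu> x1 t0 < \<infinity>"
    and "sigma_point \<mu> x0 L"
  shows "has_nontangential_limit (convolution_integral \<phi> \<mu>) L x0"
proof -
  interpret radial_kernel \<phi> by standard (use assms in auto)
  have \<mu>: "locally_additive \<mu>"
    using assms(7) unfolding complex_borel_measure_def locally_additive_def by blast
  have re: "locally_additive (\<lambda>A. Re (\<mu> A))" and im: "locally_additive (\<lambda>A. Im (\<mu> A))"
    using \<mu> unfolding locally_additive_def by (auto intro: sums_Re sums_Im)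
  \<comment> \<open>\<open>T\<close> stands for \<open>Re\<close> or \<open>Im\<close>: compatible
    with real multiples and norm-nonincreasing, so the \<sigma>-point inequality survives with the
    same \<delta>.\<close>
  have part: "\<exists>\<delta>>0. \<forall>x r. norm (x - x0) < \<delta> \<longrightarrow> 0 < r \<longrightarrow> r < \<delta> \<longrightarrow>
      \<bar>T (\<mu> (ball x r)) - T L * measure lborel (ball x r)\<bar> < \<epsilon> * (norm (x - x0) + r) ^ DIM(real ^ 'n)"
    if T: "\<And>z w c. T z - T w * c = T (z - w * of_real c)" "\<And>z. \<bar>T z\<bar> \<le> norm z" and "0 < \<epsilon>"
    for T :: "complex \<Rightarrow> real" and \<epsilon>
  proof -
    obtain \<delta> where "0 < \<delta>" "\<And>x r. norm (x - x0) < \<delta> \<Longrightarrow> 0 < r \<Longrightarrow> r < \<delta> \<Longrightarrow>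
        norm (\<mu> (ball x r) - L * of_real (measure lborel (ball x r))) < \<epsilon> * (norm (x - x0) + r) ^ DIM(real ^ 'n)"
      using assms(10) \<open>0 < \<epsilon>\<close> unfolding sigma_point_def by blast
    then show ?thesis
      unfolding T(1) by (blast intro: le_less_trans[OF T(2)])
  qed
  show ?thesis
    unfolding has_nontangential_limit_def
  proof (intro allI impI)
    fix \<alpha> :: real assume \<alpha>: "0 < \<alpha>"
    have "((\<lambda>(x, t). signed_integral (\<lambda>A. Re (\<mu> A)) (\<lambda>\<xi>. dilate \<phi> t (x - \<xi>))) \<longlongrightarrow> Re L)
        (at (x0, 0) within nontangential_cone x0 \<alpha>)"
      by (rule signed_convolution_tendsto[OF assms(7) re abs_Re_le_cmod assms(6,8,9) part \<alpha>])
        (auto simp: abs_Re_le_cmod)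
    moreover have "((\<lambda>(x, t). signed_integral (\<lambda>A. Im (\<mu> A)) (\<lambda>\<xi>. dilate \<phi> t (x - \<xi>))) \<longlongrightarrow> Im L)
        (at (x0, 0) within nontangential_cone x0 \<alpha>)"
      by (rule signed_convolution_tendsto[OF assms(7) im abs_Im_le_cmod assms(6,8,9) part \<alpha>])
        (auto simp: abs_Im_le_cmod)
    ultimately show "((\<lambda>(x, t). convolution_integral \<phi> \<mu> x t) \<longlongrightarrow> L)
        (at (x0, 0) within nontangential_cone x0 \<alpha>)"
      unfolding convolution_integral_def complex_integral_def tendsto_complex_iff
      by (simp add: case_prod_beta')
  qed
qed

end
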